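(* There exists a point $[\mu]_{B(\Delta)}$ in $B(\Delta)$ that contains more than one extremal Beltrami coefficient and such that $[\mu]_{B(\Delta)}$ contains no extremal Beltrami coefficient of constant modulus.
   Context: Let $\Delta=\{z\in\mathbb{C}:|z|<1\}$, and let $A(\Delta)$ be the Banach space of holomorphic functions $\varphi$ on $\Delta$ with $\|\varphi\|=\iint_\Delta|\varphi(z)|\,dx\,dy<\infty$. Two elements $\mu,\nu\in L^\infty(\Delta)$ (complex-valued functions) are infinitesimally equivalent if $\iint_\Delta\mu\phi\,dx\,dy=\iint_\Delta\nu\phi\,dx\,dy$ for all $\phi\in A(\Delta)$. Let $N(\Delta)$ be the set of elements of $L^\infty(\Delta)$ infinitesimally equivalent to $0$; then $B(\Delta)=L^\infty(\Delta)/N(\Delta)$, and $[\mu]_{B(\Delta)}$ denotes the set of all $\nu\in L^\infty(\Delta)$ infinitesimally equivalent to $\mu$. An element $\mu$ is extremal in $[\mu]_{B(\Delta)}$ if $\|\mu\|_\infty=\inf\{\|\nu\|_\infty:\nu\in[\mu]_{B(\Delta)}\}$; it is called an extremal Beltrami coefficient if moreover $\|\mu\|_\infty<1$. A Beltrami coefficient (an element of $L^\infty(\Delta)$ of norm less than $1$) is of constant modulus if it has the form $\mu(z)=k\,\overline{\varphi(z)}/|\varphi(z)|$, where $k\in[0,1)$ is a constant and $\varphi$ is a complex-valued (measurable) function on $\Delta$ with $\varphi\neq0$ a.e. (equivalently, $|\mu|$ is a.e. equal to a constant). Functions in $L^\infty$ are identified when they agree a.e. *)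

theory Defs
  imports "HOL-Probability.Essential_Supremum"
begin

(* Elements of the function spaces are represented by functions on the whole complex plane of
   which only the values on the open unit disc matter; functions agreeing almost everywhere on
   the disc are different representatives of one element. *)

abbreviation unit_disc :: "complex set" where
  "unit_disc \<equiv> ball 0 1"

abbreviation disc_measure :: "complex measure" where
  "disc_measure \<equiv> lebesgue_on unit_disc"

definition A_disc :: "(complex \<Rightarrow> complex) set" where
  "A_disc = {\<phi>. \<phi> holomorphic_on unit_disc \<and> integrable disc_measure \<phi>}"

(* Extended-real valued because esssup needs a complete linear order; finite on Linf_disc. *)
definition Linf_norm :: "(complex \<Rightarrow> complex) \<Rightarrow> ereal" where
  "Linf_norm \<mu> = esssup disc_measure (\<lambda>z. ereal (cmod (\<mu> z)))"

definition Linf_disc :: "(complex \<Rightarrow> complex) set" where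
  "Linf_disc = {\<mu>. \<mu> \<in> borel_measurable disc_measure \<and> Linf_norm \<mu> < \<infinity>}"

definition inf_equivalent :: "(complex \<Rightarrow> complex) \<Rightarrow> (complex \<Rightarrow> complex) \<Rightarrow> bool" where
  "inf_equivalent \<mu> \<nu> \<longleftrightarrow>
     (\<forall>\<phi>\<in>A_disc. (LINT z|disc_measure. \<mu> z * \<phi> z) = (LINT z|disc_measure. \<nu> z * \<phi> z))"

definition N_disc :: "(complex \<Rightarrow> complex) set" where
  "N_disc = {\<mu> \<in> Linf_disc. inf_equivalent \<mu> (\<lambda>z. 0)}"

(* The quotient of Linf_disc by the subspace N_disc. *)
definition B_rel :: "((complex \<Rightarrow> complex) \<times> (complex \<Rightarrow> complex)) set" where
  "B_rel = {(\<mu>, \<nu>). \<mu> \<in> Linf_disc \<and> \<nu> \<in> Linf_disc \<and> (\<lambda>z. \<mu> z - \<nu> z) \<in> N_disc}"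

definition B_disc :: "(complex \<Rightarrow> complex) set set" where
  "B_disc = Linf_disc // B_rel"

definition B_class :: "(complex \<Rightarrow> complex) \<Rightarrow> (complex \<Rightarrow> complex) set" where
  "B_class \<mu> = {\<nu> \<in> Linf_disc. inf_equivalent \<nu> \<mu>}"

definition extremal :: "(complex \<Rightarrow> complex) \<Rightarrow> bool" where
  "extremal \<mu> \<longleftrightarrow> \<mu> \<in> Linf_disc \<and> Linf_norm \<mu> = (INF \<nu>\<in>B_class \<mu>. Linf_norm \<nu>)"

definition beltrami_coefficient :: "(complex \<Rightarrow> complex) \<Rightarrow> bool" where
  "beltrami_coefficient \<mu> \<longleftrightarrow> \<mu> \<in> Linf_disc \<and> Linf_norm \<mu> < 1"

definition extremal_beltrami_coefficient :: "(complex \<Rightarrow> complex) \<Rightarrow> bool" where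
  "extremal_beltrami_coefficient \<mu> \<longleftrightarrow> extremal \<mu> \<and> Linf_norm \<mu> < 1"

definition constant_modulus :: "(complex \<Rightarrow> complex) \<Rightarrow> bool" where
  "constant_modulus \<mu> \<longleftrightarrow> beltrami_coefficient \<mu> \<and>
     (\<exists>k::real. \<exists>\<phi>. 0 \<le> k \<and> k < 1 \<and> \<phi> \<in> borel_measurable disc_measure \<and>
        (AE z in disc_measure. \<phi> z \<noteq> 0) \<and>
        (AE z in disc_measure. \<mu> z = of_real k * cnj (\<phi> z) / of_real (cmod (\<phi> z))))"

lemma Linf_disc_AE_bound:
  assumes "\<mu> \<in> Linf_disc"
  obtains c :: real where "c \<ge> 0" "AE z in disc_measure. cmod (\<mu> z) \<le> c"
proof -
  have ae: "AE z in disc_measure. ereal (cmod (\<mu> z)) \<le> Linf_norm \<mu>"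
    unfolding Linf_norm_def by (rule esssup_AE)
  have "Linf_norm \<mu> < \<infinity>" using assms by (simp add: Linf_disc_def)
  then obtain c where c: "Linf_norm \<mu> \<le> ereal c"
    by (cases "Linf_norm \<mu>") auto
  show thesis
  proof (rule that[of "max c 0"])
    show "AE z in disc_measure. cmod (\<mu> z) \<le> max c 0"
      using ae by eventually_elim (use c in \<open>metis ereal_less_eq(3) le_max_iff_disj order_trans\<close>)
  qed simp
qed

lemma Linf_disc_I:
  assumes "\<mu> \<in> borel_measurable disc_measure" "AE z in disc_measure. cmod (\<mu> z) \<le> c"
  shows "\<mu> \<in> Linf_disc"
proof -
  have "Linf_norm \<mu> \<le> ereal c"
    unfolding Linf_norm_def using assms by (intro esssup_I) auto
  then show ?thesis using assms by (auto simp: Linf_disc_def)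
qed

lemma Linf_disc_diff:
  assumes "\<mu> \<in> Linf_disc" "\<nu> \<in> Linf_disc"
  shows "(\<lambda>z. \<mu> z - \<nu> z) \<in> Linf_disc"
proof -
  obtain c where c: "AE z in disc_measure. cmod (\<mu> z) \<le> c"
    using Linf_disc_AE_bound assms(1) by metis
  obtain d where d: "AE z in disc_measure. cmod (\<nu> z) \<le> d"
    using Linf_disc_AE_bound assms(2) by metis
  show ?thesis
  proof (rule Linf_disc_I)
    show "(\<lambda>z. \<mu> z - \<nu> z) \<in> borel_measurable disc_measure"
      using assms by (auto simp: Linf_disc_def)
    show "AE z in disc_measure. cmod (\<mu> z - \<nu> z) \<le> c + d"
      using c d by eventually_elim (metis add_mono norm_triangle_ineq4 order_trans)
  qed
qed

lemma integrable_Linf_mult: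
  assumes "\<mu> \<in> Linf_disc" "\<phi> \<in> A_disc"
  shows "integrable disc_measure (\<lambda>z. \<mu> z * \<phi> z)"
proof -
  obtain c where c: "c \<ge> 0" "AE z in disc_measure. cmod (\<mu> z) \<le> c"
    using Linf_disc_AE_bound assms(1) by metis
  have i: "integrable disc_measure \<phi>" using assms by (simp add: A_disc_def)
  have [measurable]: "\<mu> \<in> borel_measurable disc_measure" using assms by (simp add: Linf_disc_def)
  have [measurable]: "\<phi> \<in> borel_measurable disc_measure" using i by (rule borel_measurable_integrable)
  show ?thesis
  proof (rule Bochner_Integration.integrable_bound)
    show "integrable disc_measure (\<lambda>z. of_real c * \<phi> z)" using i by simp
    show "AE z in disc_measure. norm (\<mu> z * \<phi> z) \<le> norm (of_real c * \<phi> z)"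
      using c(2) by eventually_elim (use c(1) in \<open>simp add: norm_mult mult_right_mono\<close>)
  qed measurable
qed

lemma B_rel_iff:
  "(\<mu>, \<nu>) \<in> B_rel \<longleftrightarrow> \<mu> \<in> Linf_disc \<and> \<nu> \<in> Linf_disc \<and> inf_equivalent \<mu> \<nu>"
  by (auto simp: B_rel_def N_disc_def Linf_disc_diff inf_equivalent_def left_diff_distrib
      integrable_Linf_mult)

lemma equiv_B_rel: "equiv Linf_disc B_rel"
  by (rule equivI) (auto simp: B_rel_iff inf_equivalent_def refl_on_def sym_def trans_def)

lemma B_disc_eq: "B_disc = B_class ` Linf_disc"
proof -
  have "B_rel `` {\<mu>} = B_class \<mu>" if "\<mu> \<in> Linf_disc" for \<mu>
    using that by (auto simp: B_rel_iff B_class_def inf_equivalent_def)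
  then show ?thesis by (auto simp: B_disc_def quotient_def)
qed

lemma B_disc_member: "P \<in> B_disc \<Longrightarrow> \<mu> \<in> P \<Longrightarrow> B_class \<mu> = P"
  by (auto simp: B_disc_eq B_class_def inf_equivalent_def)

end

theory Submission
  imports Defs "HOL-Complex_Analysis.Cauchy_Integral_Formula"
begin

text \<open>
  Let \<open>U\<close> be an open set of reals which contains a neighbourhood of 0, is dense to the right of 0, has no
  points left of \<open>-1/8\<close>, and is so thin that the set \<open>E\<close> of all \<open>z\<close> in the disc with \<open>Re z > 0\<close> and
  \<open>Re z \<notin> U\<close> has positive area (\<open>thin_dense_open\<close>).  Call the set \<open>{z. Re z \<in> U}\<close> the strips.  The class of the
  theorem is that of a coefficient \<open>\<mu>\<close> which vanishes off the strips and has modulus \<open>1/2\<close> on them.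

  The phase of \<open>\<mu>\<close> on the strips is chosen such that every \<open>\<nu>\<close> in the class of \<open>\<mu>\<close> with \<open>|\<nu>| \<le> 1/2\<close> agrees with
  \<open>\<mu>\<close> on the strips (\<open>forced_coefficient\<close>).  For this, one constructs integrable holomorphic \<open>\<phi> n\<close> that tend to 0
  off the strips and to a zero-free function \<open>\<phi>\<^sub>0\<close> on the strips (\<open>degenerating_sequence\<close>); \<open>\<mu>\<close> takes the conjugate
  phase of \<open>\<phi>\<^sub>0\<close>, so that \<open>\<phi> n\<close> is a Hamilton sequence for \<open>\<mu>\<close>.  It follows that the least norm in the class is
  \<open>1/2\<close>, and that an extremal coefficient of constant modulus would have modulus \<open>1/2\<close> almost everywhere.

  The difference of \<open>\<mu>\<close> and an extremal coefficient of the class lives off the strips and annihilates all integrable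
  holomorphic functions.  Since \<open>U\<close> is dense to the right of 0, a Runge type argument (\<open>hinf_approx_step\<close>) shows that
  step functions of \<open>Re z\<close> with jumps in \<open>U\<close> are, off the strips, uniform limits of bounded holomorphic functions;
  hence so are all continuous functions on \<open>E\<close>, and the difference is 0 on \<open>E\<close> (\<open>annihilator_zero_right_half\<close>).  So
  every extremal coefficient vanishes on \<open>E\<close> and none has constant modulus.

  Left of the strips there is a whole disc on which \<open>\<mu>\<close> is 0.  Adding to \<open>\<mu>\<close> a small bounded function that is supported
  in this disc and annihilates the holomorphic functions (\<open>annihilator_bump\<close>) gives a second extremal coefficient.
\<close>

section \<open>Uniform approximation by bounded holomorphic functions\<close>

text \<open>The function \<open>g\<close> is a uniform limit on \<open>X\<close> of bounded holomorphic functions on the disc.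
  Only the values of \<open>g\<close> on \<open>X\<close> matter.  For \<open>X\<close> inside the disc these \<open>g\<close> form an algebra that is
  closed under uniform convergence; bounded holomorphic functions belong to \<open>A_disc\<close>.\<close>
definition hinf_approx :: "complex set \<Rightarrow> (complex \<Rightarrow> complex) \<Rightarrow> bool" where
  "hinf_approx X g \<longleftrightarrow> (\<forall>\<epsilon>>0. \<exists>f. f holomorphic_on unit_disc \<and> bounded (f ` unit_disc) \<and>
     (\<forall>z\<in>X. cmod (f z - g z) < \<epsilon>))"

lemma hinf_approxE:
  assumes "hinf_approx X g" "\<epsilon> > 0"
  obtains f where "f holomorphic_on unit_disc" "bounded (f ` unit_disc)"
    "\<And>z. z \<in> X \<Longrightarrow> cmod (f z - g z) < \<epsilon>"
  using assms unfolding hinf_approx_def by metis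

lemma hinf_approx_holomorphic:
  "\<lbrakk>f holomorphic_on unit_disc; bounded (f ` unit_disc)\<rbrakk> \<Longrightarrow> hinf_approx X f"
  unfolding hinf_approx_def by (intro allI impI exI[of _ f]) auto

lemma hinf_approx_const [intro]: "hinf_approx X (\<lambda>z. c)"
  by (rule hinf_approx_holomorphic) (auto simp: image_constant_conv)

lemma hinf_approx_id [intro]: "hinf_approx X (\<lambda>z. z)"
  by (rule hinf_approx_holomorphic) auto

lemma hinf_approx_cong:
  "hinf_approx X f \<Longrightarrow> (\<And>z. z \<in> X \<Longrightarrow> f z = g z) \<Longrightarrow> hinf_approx X g"
  unfolding hinf_approx_def by simp

lemma hinf_approx_uniform_limit:
  assumes "\<And>\<epsilon>. \<epsilon> > 0 \<Longrightarrow> \<exists>f. hinf_approx X f \<and> (\<forall>z\<in>X. cmod (f z - g z) \<le> \<epsilon>)"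
  shows "hinf_approx X g"
  unfolding hinf_approx_def
proof (intro allI impI)
  fix \<epsilon> :: real assume \<epsilon>: "\<epsilon> > 0"
  then obtain f where f: "hinf_approx X f" "\<And>z. z \<in> X \<Longrightarrow> cmod (f z - g z) \<le> \<epsilon>/2"
    using assms[of "\<epsilon>/2"] by auto
  obtain h where h: "h holomorphic_on unit_disc" "bounded (h ` unit_disc)"
    "\<And>z. z \<in> X \<Longrightarrow> cmod (h z - f z) < \<epsilon>/2"
    using hinf_approxE[OF f(1), of "\<epsilon>/2"] \<epsilon> by auto
  show "\<exists>f. f holomorphic_on unit_disc \<and> bounded (f ` unit_disc) \<and> (\<forall>z\<in>X. cmod (f z - g z) < \<epsilon>)"
  proof (intro exI[of _ h] conjI ballI h)
    fix z assume "z \<in> X"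
    then show "cmod (h z - g z) < \<epsilon>"
      using f(2) h(3) norm_triangle_ineq[of "h z - f z" "f z - g z"] by fastforce
  qed
qed

lemma hinf_approx_add:
  assumes "hinf_approx X f" "hinf_approx X g"
  shows "hinf_approx X (\<lambda>z. f z + g z)"
  unfolding hinf_approx_def
proof (intro allI impI)
  fix \<epsilon> :: real assume \<epsilon>: "\<epsilon> > 0"
  obtain f' where f': "f' holomorphic_on unit_disc" "bounded (f' ` unit_disc)"
    "\<And>z. z \<in> X \<Longrightarrow> cmod (f' z - f z) < \<epsilon>/2"
    using hinf_approxE[OF assms(1), of "\<epsilon>/2"] \<epsilon> by auto
  obtain g' where g': "g' holomorphic_on unit_disc" "bounded (g' ` unit_disc)"
    "\<And>z. z \<in> X \<Longrightarrow> cmod (g' z - g z) < \<epsilon>/2"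
    using hinf_approxE[OF assms(2), of "\<epsilon>/2"] \<epsilon> by auto
  show "\<exists>h. h holomorphic_on unit_disc \<and> bounded (h ` unit_disc) \<and>
      (\<forall>z\<in>X. cmod (h z - (f z + g z)) < \<epsilon>)"
  proof (intro exI[of _ "\<lambda>z. f' z + g' z"] conjI ballI)
    fix z assume "z \<in> X"
    then show "cmod (f' z + g' z - (f z + g z)) < \<epsilon>"
      using f'(3) g'(3) norm_triangle_ineq[of "f' z - f z" "g' z - g z"]
      by (fastforce simp: algebra_simps)
  qed (use f' g' in \<open>auto intro: holomorphic_intros bounded_plus_comp\<close>)
qed

lemma hinf_approx_bounded:
  assumes "hinf_approx X f" "X \<subseteq> unit_disc"
  obtains B where "B > 0" "\<And>z. z \<in> X \<Longrightarrow> cmod (f z) \<le> B"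
proof -
  obtain f' where f': "bounded (f' ` unit_disc)" "\<And>z. z \<in> X \<Longrightarrow> cmod (f' z - f z) < 1"
    using hinf_approxE[OF assms(1), of 1] by auto
  obtain b where b: "\<And>z. z \<in> unit_disc \<Longrightarrow> cmod (f' z) \<le> b"
    using f'(1) unfolding bounded_iff by (metis imageI)
  have "cmod (f z) \<le> max b 0 + 1" if "z \<in> X" for z
  proof -
    have "cmod (f' z) \<le> b" using b assms(2) that by blast
    then show ?thesis using f'(2)[OF that] norm_triangle_sub[of "f z" "f' z"]
      by (simp add: norm_minus_commute)
  qed
  then show thesis by (intro that[of "max b 0 + 1"]) auto
qed

lemma bounded_mult_image:
  fixes f g :: "'a \<Rightarrow> complex"
  assumes "bounded (f ` S)" "bounded (g ` S)"
  shows "bounded ((\<lambda>x. f x * g x) ` S)"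
proof -
  obtain a b where "\<And>x. x \<in> S \<Longrightarrow> cmod (f x) \<le> a" "\<And>x. x \<in> S \<Longrightarrow> cmod (g x) \<le> b"
    using assms unfolding bounded_iff by auto
  then have "cmod (f x * g x) \<le> a * b" if "x \<in> S" for x
    using that unfolding norm_mult by (meson mult_mono norm_ge_zero order_trans)
  then show ?thesis unfolding bounded_iff by auto
qed

lemma hinf_approx_mult:
  assumes "X \<subseteq> unit_disc" "hinf_approx X f" "hinf_approx X g"
  shows "hinf_approx X (\<lambda>z. f z * g z)"
  unfolding hinf_approx_def
proof (intro allI impI)
  fix \<epsilon> :: real assume \<epsilon>: "\<epsilon> > 0"
  obtain B where B: "B > 0" "\<And>z. z \<in> X \<Longrightarrow> cmod (f z) \<le> B"
    using hinf_approx_bounded assms by metis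
  obtain g' where g': "g' holomorphic_on unit_disc" "bounded (g' ` unit_disc)"
    "\<And>z. z \<in> X \<Longrightarrow> cmod (g' z - g z) < \<epsilon>/(2*B)"
    using hinf_approxE[OF assms(3), of "\<epsilon>/(2*B)"] \<epsilon> B by auto
  obtain C where C: "C > 0" "\<And>z. z \<in> unit_disc \<Longrightarrow> cmod (g' z) \<le> C"
    using g'(2) unfolding bounded_pos by auto
  obtain f' where f': "f' holomorphic_on unit_disc" "bounded (f' ` unit_disc)"
    "\<And>z. z \<in> X \<Longrightarrow> cmod (f' z - f z) < \<epsilon>/(2*C)"
    using hinf_approxE[OF assms(2), of "\<epsilon>/(2*C)"] \<epsilon> C by auto
  show "\<exists>h. h holomorphic_on unit_disc \<and> bounded (h ` unit_disc) \<and>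
      (\<forall>z\<in>X. cmod (h z - f z * g z) < \<epsilon>)"
  proof (intro exI[of _ "\<lambda>z. f' z * g' z"] conjI ballI)
    fix z assume z: "z \<in> X"
    have zd: "z \<in> unit_disc" using z assms(1) by blast
    have "cmod ((f' z - f z) * g' z) < \<epsilon>/2"
    proof -
      have "cmod (f' z - f z) * cmod (g' z) \<le> cmod (f' z - f z) * C"
        using C(2)[OF zd] by (simp add: mult_left_mono)
      also have "\<dots> < \<epsilon>/(2*C) * C" using f'(3)[OF z] C by (intro mult_strict_right_mono)
      finally show ?thesis using C by (simp add: norm_mult)
    qed
    moreover have "cmod (f z * (g' z - g z)) \<le> \<epsilon>/2"
    proof -
      have "cmod (f z) * cmod (g' z - g z) \<le> B * (\<epsilon>/(2*B))"
        using B(2)[OF z] g'(3)[OF z] B by (intro mult_mono) auto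
      then show ?thesis using B by (simp add: norm_mult)
    qed
    ultimately show "cmod (f' z * g' z - f z * g z) < \<epsilon>"
      using norm_triangle_ineq[of "(f' z - f z) * g' z" "f z * (g' z - g z)"]
      by (simp add: algebra_simps)
  qed (use f' g' in \<open>auto intro: holomorphic_intros bounded_mult_image\<close>)
qed

lemma hinf_approx_cmult: "X \<subseteq> unit_disc \<Longrightarrow> hinf_approx X f \<Longrightarrow> hinf_approx X (\<lambda>z. c * f z)"
  by (rule hinf_approx_mult) auto

lemma hinf_approx_diff:
  assumes "X \<subseteq> unit_disc" "hinf_approx X f" "hinf_approx X g"
  shows "hinf_approx X (\<lambda>z. f z - g z)"
  using hinf_approx_add[OF assms(2) hinf_approx_cmult[OF assms(1,3), of "-1"]] by simp

lemma hinf_approx_power: "X \<subseteq> unit_disc \<Longrightarrow> hinf_approx X f \<Longrightarrow> hinf_approx X (\<lambda>z. f z ^ n)"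
  by (induction n) (auto intro: hinf_approx_mult)

lemma hinf_approx_sum:
  assumes "\<And>i. i \<in> I \<Longrightarrow> hinf_approx X (f i)"
  shows "hinf_approx X (\<lambda>z. \<Sum>i\<in>I. f i z)"
  using assms by (induction I rule: infinite_finite_induct) (auto intro: hinf_approx_add)

lemma hinf_approx_geometric:
  assumes X: "X \<subseteq> unit_disc" and g: "hinf_approx X g"
    and le: "\<And>z. z \<in> X \<Longrightarrow> cmod (g z) \<le> 1/2"
  shows "hinf_approx X (\<lambda>z. 1 / (1 - g z))"
proof (rule hinf_approx_uniform_limit)
  fix \<epsilon> :: real assume "\<epsilon> > 0"
  then obtain n where n: "(1/2::real)^n < \<epsilon>/2"
    using real_arch_pow_inv[of "\<epsilon>/2" "1/2"] by auto
  have "cmod ((\<Sum>i<n. g z ^ i) - 1 / (1 - g z)) \<le> \<epsilon>" if z: "z \<in> X" for z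
  proof -
    have a: "1/2 \<le> cmod (1 - g z)"
      using le[OF z] norm_triangle_ineq2[of 1 "g z"] by simp
    then have "g z \<noteq> 1" by auto
    then have "(\<Sum>i<n. g z ^ i) - 1 / (1 - g z) = - (g z ^ n) / (1 - g z)"
      by (simp add: geometric_sum divide_simps) (simp add: algebra_simps)
    also have "cmod \<dots> = cmod (g z) ^ n / cmod (1 - g z)"
      by (simp add: norm_divide norm_power)
    also have "\<dots> \<le> (1/2)^n / (1/2)"
      using a le[OF z] by (intro frac_le power_mono) auto
    finally show ?thesis using n by simp
  qed
  then show "\<exists>f. hinf_approx X f \<and> (\<forall>z\<in>X. cmod (f z - 1 / (1 - g z)) \<le> \<epsilon>)"
    by (intro exI[of _ "\<lambda>z. \<Sum>i<n. g z ^ i"])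
      (auto intro!: hinf_approx_sum hinf_approx_power X g)
qed

text \<open>Runge's pole pushing: for large \<open>s\<close> the function \<open>1 / (g - \<i> s)\<close> is a geometric series in \<open>g\<close>, and
  because \<open>g\<close> avoids the strip of width \<open>2 \<delta>\<close> about the imaginary axis, the pole can be moved
  in steps of \<open>\<delta>/2\<close> down to the origin.\<close>
lemma hinf_approx_inverse:
  assumes X: "X \<subseteq> unit_disc" and g: "hinf_approx X g" and "\<delta> > 0"
    and ge: "\<And>z. z \<in> X \<Longrightarrow> \<delta> \<le> \<bar>Re (g z)\<bar>"
  shows "hinf_approx X (\<lambda>z. 1 / g z)"
proof -
  obtain B where B: "B > 0" "\<And>z. z \<in> X \<Longrightarrow> cmod (g z) \<le> B"
    using hinf_approx_bounded[OF g X] by metis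
  have low: "\<delta> \<le> cmod (g z - \<i> * of_real s)" if "z \<in> X" for z s
    using ge[OF that] abs_Re_le_cmod[of "g z - \<i> * of_real s"] by simp
  have far: "hinf_approx X (\<lambda>z. 1 / (g z - \<i> * of_real s))" if s: "s \<ge> 2 * B" for s
  proof -
    have "s > 0" using s B by linarith
    have "hinf_approx X (\<lambda>z. (\<i> / of_real s) * (1 / (1 - (- \<i> / of_real s) * g z)))"
    proof (intro hinf_approx_cmult hinf_approx_geometric X g)
      fix z assume "z \<in> X"
      then show "cmod (- \<i> / of_real s * g z) \<le> 1/2"
        using B(2)[of z] s \<open>s > 0\<close> by (simp add: norm_mult norm_divide divide_simps)
    qed
    then show ?thesis
    proof (rule hinf_approx_cong)
      fix z assume "z \<in> X"
      then have "g z - \<i> * of_real s \<noteq> 0" using low[of z s] \<open>\<delta> > 0\<close> by auto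
      moreover have "1 - (- \<i> / of_real s) * g z = (\<i> / of_real s) * (g z - \<i> * of_real s)"
        using \<open>s > 0\<close> by (simp add: field_simps)
      ultimately show "(\<i> / of_real s) * (1 / (1 - (- \<i> / of_real s) * g z)) = 1 / (g z - \<i> * of_real s)"
        using \<open>s > 0\<close> by simp
    qed
  qed
  have step: "hinf_approx X (\<lambda>z. 1 / (g z - \<i> * of_real s))"
    if "hinf_approx X (\<lambda>z. 1 / (g z - \<i> * of_real (s + \<delta>/2)))" for s
  proof -
    define r where "r z = 1 / (g z - \<i> * of_real (s + \<delta>/2))" for z
    have "hinf_approx X (\<lambda>z. r z * (1 / (1 - (- \<i> * of_real (\<delta>/2)) * r z)))"
    proof (intro hinf_approx_cmult hinf_approx_geometric hinf_approx_mult X)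
      fix z assume "z \<in> X"
      then show "cmod (- \<i> * of_real (\<delta>/2) * r z) \<le> 1/2"
        using low[of z "s + \<delta>/2"] \<open>\<delta> > 0\<close>
        by (simp add: r_def norm_mult norm_divide divide_simps)
    qed (use that in \<open>simp_all add: r_def\<close>)
    then show ?thesis
    proof (rule hinf_approx_cong)
      fix z assume "z \<in> X"
      define w where "w = g z - \<i> * of_real (s + \<delta>/2)"
      have e: "g z - \<i> * of_real s = w + \<i> * of_real (\<delta>/2)" by (simp add: w_def algebra_simps)
      have "w \<noteq> 0" "w + \<i> * of_real (\<delta>/2) \<noteq> 0"
        using low[of z "s + \<delta>/2"] low[of z s] \<open>\<delta> > 0\<close> \<open>z \<in> X\<close> by (auto simp: w_def e)
      then show "r z * (1 / (1 - (- \<i> * of_real (\<delta>/2)) * r z)) = 1 / (g z - \<i> * of_real s)"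
        unfolding e r_def w_def[symmetric] by (simp add: field_simps)
    qed
  qed
  have "hinf_approx X (\<lambda>z. 1 / (g z - \<i> * of_real s))" if "s + real n * (\<delta>/2) \<ge> 2 * B" for s n
    using that
  proof (induction n arbitrary: s)
    case 0
    then show ?case using far by simp
  next
    case (Suc n)
    have "hinf_approx X (\<lambda>z. 1 / (g z - \<i> * of_real (s + \<delta>/2)))"
      using Suc.prems by (intro Suc.IH) (simp add: field_simps)
    then show ?case by (rule step)
  qed
  moreover obtain n where "2 * B < real n * (\<delta>/2)"
    using reals_Archimedean3[of "\<delta>/2"] \<open>\<delta> > 0\<close> by (meson half_gt_zero)
  ultimately show ?thesis by (metis (no_types, lifting) ext add_0 less_imp_le mult_zero_right of_real_0 diff_zero)
qed

section \<open>Step functions as uniform limits\<close>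

text \<open>Newton's iteration for the square roots of 1.  It converges to \<open>1\<close> on the right half plane and
  to \<open>-1\<close> on the left one, because the Cayley transform conjugates it to squaring.\<close>
primrec newton_sgn :: "nat \<Rightarrow> complex \<Rightarrow> complex" where
  "newton_sgn 0 w = w"
| "newton_sgn (Suc n) w = (newton_sgn n w + 1 / newton_sgn n w) / 2"

lemma newton_sgn_minus: "newton_sgn n (- w) = - newton_sgn n w"
  by (induction n) (auto simp: divide_simps)

lemma abs_Re_newton_step:
  assumes "Re v \<noteq> 0"
  shows "\<bar>Re v\<bar> / 2 \<le> \<bar>Re ((v + 1 / v) / 2)\<bar>" "Re v > 0 \<Longrightarrow> Re ((v + 1 / v) / 2) > 0"
proof -
  have v: "v \<noteq> 0" using assms by auto
  have e: "Re ((v + 1 / v) / 2) = Re v / 2 * (1 + 1 / (cmod v)^2)"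
    by (simp add: Re_divide' cmod_power2 field_simps)
  have "\<bar>Re v / 2\<bar> * 1 \<le> \<bar>Re v / 2\<bar> * \<bar>1 + 1 / (cmod v)^2\<bar>"
    by (intro mult_left_mono) auto
  then show "\<bar>Re v\<bar> / 2 \<le> \<bar>Re ((v + 1 / v) / 2)\<bar>" unfolding e by (simp add: abs_mult)
  assume "Re v > 0"
  then show "Re ((v + 1 / v) / 2) > 0" unfolding e by (simp add: add_pos_nonneg)
qed

lemma newton_sgn_cayley:
  assumes "Re w > 0"
  shows "Re (newton_sgn n w) > 0 \<and>
    (newton_sgn n w - 1) / (newton_sgn n w + 1) = ((w - 1) / (w + 1)) ^ (2 ^ n)"
proof (induction n)
  case 0
  then show ?case using assms by simp
next
  case (Suc n)
  define v where "v = newton_sgn n w"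
  have v: "Re v > 0" using Suc by (simp add: v_def)
  have nz: "v \<noteq> 0" "v + 1 \<noteq> 0" using v by (auto simp: complex_eq_iff)
  have pos: "Re (newton_sgn (Suc n) w) > 0"
    using abs_Re_newton_step(2)[of v] v by (simp add: v_def)
  have "((v + 1 / v) / 2 - 1) / ((v + 1 / v) / 2 + 1) = ((v - 1) ^ 2 / (2 * v)) / ((v + 1) ^ 2 / (2 * v))"
    using nz by (intro arg_cong2[where f="(/)"]) (simp_all add: field_simps power2_eq_square)
  also have "\<dots> = ((v - 1) / (v + 1)) ^ 2" using nz by (simp add: power_divide)
  also have "\<dots> = ((w - 1) / (w + 1)) ^ (2 ^ Suc n)"
    using Suc by (simp add: v_def power_mult[symmetric] mult.commute)
  finally show ?case using pos by (simp add: v_def)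
qed

lemma newton_sgn_uniform:
  assumes "\<delta> > 0" "M > 0" "\<epsilon> > 0"
  obtains n where "\<And>w. Re w \<ge> \<delta> \<Longrightarrow> cmod w \<le> M \<Longrightarrow> cmod (newton_sgn n w - 1) \<le> \<epsilon>"
proof -
  define \<rho> where "\<rho> = max 0 (1 - 4 * \<delta> / (M + 1)^2)"
  have \<rho>: "0 \<le> \<rho>" "\<rho> < 1" using assms by (auto simp: \<rho>_def)
  define \<eta> where "\<eta> = min (1/2) (\<epsilon>/4)"
  have \<eta>: "\<eta> > 0" "\<eta> \<le> 1/2" "4 * \<eta> \<le> \<epsilon>" using assms by (auto simp: \<eta>_def)
  then have "\<eta>^2 > 0" by simp
  then obtain n where n: "\<rho> ^ n < \<eta>^2" using real_arch_pow_inv \<rho>(2) by blast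
  show thesis
  proof (rule that)
    fix w assume w: "Re w \<ge> \<delta>" "cmod w \<le> M"
    define C where "C = ((w - 1) / (w + 1)) ^ (2 ^ n)"
    define v where "v = newton_sgn n w"
    have v: "Re v > 0" "(v - 1) / (v + 1) = C"
      using newton_sgn_cayley[of w n] w assms by (auto simp: v_def C_def)
    have v1: "v + 1 \<noteq> 0" using v(1) by (auto simp: complex_eq_iff)
    have w1: "cmod (w + 1) > 0" using w assms by (auto simp: complex_eq_iff)
    have "(cmod (w - 1))^2 = (cmod (w + 1))^2 - 4 * Re w"
      unfolding cmod_power2 by (simp add: power2_eq_square algebra_simps)
    then have "(cmod ((w - 1) / (w + 1)))^2 = 1 - 4 * Re w / (cmod (w + 1))^2"
      using w1 by (simp add: norm_divide power_divide field_simps)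
    also have "\<dots> \<le> 1 - 4 * \<delta> / (M + 1)^2"
    proof -
      have "cmod (w + 1) \<le> M + 1" using norm_triangle_ineq[of w 1] w by simp
      then have "4 * \<delta> / (M + 1)^2 \<le> 4 * Re w / (cmod (w + 1))^2"
        using w w1 assms by (intro frac_le power_mono) auto
      then show ?thesis by simp
    qed
    also have "\<dots> \<le> \<rho>" by (simp add: \<rho>_def)
    finally have q: "(cmod ((w - 1) / (w + 1)))^2 \<le> \<rho>" .
    have "(cmod C)^2 = ((cmod ((w - 1) / (w + 1)))^2) ^ (2 ^ n)"
      by (simp add: C_def norm_power norm_divide power_mult[symmetric] mult.commute)
    also have "\<dots> \<le> \<rho> ^ (2 ^ n)" using q by (intro power_mono) auto
    also have "\<dots> \<le> \<rho> ^ n" using \<rho> by (intro power_decreasing) (auto intro: less_imp_le less_exp)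
    also have "\<dots> < \<eta>^2" by (rule n)
    finally have C: "cmod C < \<eta>" using \<eta>(1) by (simp add: power2_less_imp_less)
    have "v - 1 = C * (v + 1)" using v v1 by (simp add: field_simps)
    then have "(v - 1) * (1 - C) = 2 * C" by (simp add: algebra_simps)
    then have "cmod (v - 1) * cmod (1 - C) = 2 * cmod C"
      by (metis norm_mult norm_numeral)
    moreover have "1/2 \<le> cmod (1 - C)"
      using norm_triangle_ineq2[of 1 C] C \<eta>(2) by simp
    ultimately have "cmod (v - 1) * (1/2) \<le> 2 * cmod C"
      by (metis mult_left_mono norm_ge_zero)
    then show "cmod (newton_sgn n w - 1) \<le> \<epsilon>" using C \<eta>(3) by (simp add: v_def)
  qed
qed

text \<open>The iterates of Newton's method stay in the algebra: each one keeps a positive distance from the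
  imaginary axis, so it can be inverted there.\<close>
lemma hinf_approx_sgn:
  assumes X: "X \<subseteq> unit_disc" and g: "hinf_approx X g" and "\<delta> > 0"
    and ge: "\<And>z. z \<in> X \<Longrightarrow> \<delta> \<le> \<bar>Re (g z)\<bar>"
  shows "hinf_approx X (\<lambda>z. if Re (g z) > 0 then 1 else -1)"
proof (rule hinf_approx_uniform_limit)
  fix \<epsilon> :: real assume "\<epsilon> > 0"
  obtain B where B: "B > 0" "\<And>z. z \<in> X \<Longrightarrow> cmod (g z) \<le> B"
    using hinf_approx_bounded[OF g X] by metis
  obtain n where n: "\<And>w. Re w \<ge> \<delta> \<Longrightarrow> cmod w \<le> B \<Longrightarrow> cmod (newton_sgn n w - 1) \<le> \<epsilon>"
    using newton_sgn_uniform[OF \<open>\<delta> > 0\<close> B(1) \<open>\<epsilon> > 0\<close>] by metis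
  have approx: "hinf_approx X (\<lambda>z. newton_sgn n (g z)) \<and> (\<forall>z\<in>X. \<delta> / 2^n \<le> \<bar>Re (newton_sgn n (g z))\<bar>)" for n
  proof (induction n)
    case 0
    then show ?case using g ge by simp
  next
    case (Suc n)
    have "hinf_approx X (\<lambda>z. (1/2) * (newton_sgn n (g z) + 1 / newton_sgn n (g z)))"
      using Suc \<open>\<delta> > 0\<close>
      by (intro hinf_approx_cmult hinf_approx_add hinf_approx_inverse[where \<delta>="\<delta> / 2^n"] X) auto
    moreover have "\<delta> / 2^Suc n \<le> \<bar>Re (newton_sgn (Suc n) (g z))\<bar>" if "z \<in> X" for z
    proof -
      have a: "\<delta> / 2^n \<le> \<bar>Re (newton_sgn n (g z))\<bar>" using Suc that by blast
      have "\<delta> / 2^n > 0" using \<open>\<delta> > 0\<close> by simp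
      then have "Re (newton_sgn n (g z)) \<noteq> 0" using a by linarith
      from abs_Re_newton_step(1)[OF this] a show ?thesis by simp
    qed
    ultimately show ?case by simp
  qed
  show "\<exists>f. hinf_approx X f \<and> (\<forall>z\<in>X. cmod (f z - (if Re (g z) > 0 then 1 else -1)) \<le> \<epsilon>)"
  proof (intro exI[of _ "\<lambda>z. newton_sgn n (g z)"] conjI ballI)
    fix z assume z: "z \<in> X"
    show "cmod (newton_sgn n (g z) - (if Re (g z) > 0 then 1 else -1)) \<le> \<epsilon>"
    proof (cases "Re (g z) > 0")
      case True
      then show ?thesis using n[of "g z"] ge[OF z] B(2)[OF z] by simp
    next
      case False
      then have "cmod (newton_sgn n (- g z) - 1) \<le> \<epsilon>"
        using ge[OF z] B(2)[OF z] by (intro n) auto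
      then have "cmod (- (newton_sgn n (g z) + 1)) \<le> \<epsilon>"
        by (simp add: newton_sgn_minus)
      then show ?thesis using False by (simp only: norm_minus_cancel) simp
    qed
  qed (use approx in auto)
qed

lemma hinf_approx_step:
  assumes X: "X \<subseteq> unit_disc" and "\<delta> > 0" and ge: "\<And>z. z \<in> X \<Longrightarrow> \<delta> \<le> \<bar>Re z - t\<bar>"
  shows "hinf_approx X (\<lambda>z. if Re z > t then 1 else 0)"
proof -
  have "hinf_approx X (\<lambda>z. if Re (z - of_real t) > 0 then 1 else -1)"
    using ge \<open>\<delta> > 0\<close> by (intro hinf_approx_sgn[where \<delta>=\<delta>] hinf_approx_diff X) auto
  then have "hinf_approx X (\<lambda>z. (1/2) * (1 + (if Re (z - of_real t) > 0 then 1 else -1)))"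
    by (intro hinf_approx_cmult hinf_approx_add X) auto
  then show ?thesis by (rule hinf_approx_cong) auto
qed

text \<open>A component \<open>Q\<close> of \<open>U\<close> is an interval that meets the compact set \<open>L\<close> in a compact set.  Hence there is
  room in \<open>Q\<close>, on both sides of \<open>L \<inter> Q\<close>, for the jumps of two step functions.\<close>
lemma hinf_approx_component:
  fixes U L :: "real set"
  assumes L: "compact L" "L \<subseteq> U" and U: "open U" and Q: "Q \<in> components U"
    and X: "X = {z \<in> unit_disc. Re z \<in> L \<or> Re z \<notin> U}"
  shows "hinf_approx X (\<lambda>z. if Re z \<in> Q then 1 else 0)"
proof (cases "L \<inter> Q = {}")
  case True
  have "Q \<subseteq> U" using Q by (rule in_components_subset)
  then show ?thesis using True
    by (intro hinf_approx_cong[OF hinf_approx_const[of X 0]]) (auto simp: X)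
next
  case False
  have QU: "Q \<subseteq> U" using Q by (rule in_components_subset)
  have oQ: "open Q" using open_components U Q by blast
  have iQ: "is_interval Q" using in_components_connected[OF Q] by (simp add: is_interval_connected_1)
  have "L \<inter> Q = L - \<Union>(components U - {Q})"
  proof -
    have "L \<subseteq> \<Union>(components U)" using L by (simp add: Union_components)
    moreover have "Q \<inter> Q' = {}" if "Q' \<in> components U - {Q}" for Q'
      using components_nonoverlap Q that by (metis Diff_iff insertI1)
    ultimately show ?thesis using Q by blast
  qed
  moreover have "open (\<Union>(components U - {Q}))" using open_components[OF U] by blast
  ultimately have "compact (L \<inter> Q)" using L(1) by (simp add: compact_diff)
  then obtain m M where mM: "m \<in> L \<inter> Q" "M \<in> L \<inter> Q" "\<And>x. x \<in> L \<inter> Q \<Longrightarrow> m \<le> x \<and> x \<le> M"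
    using compact_attains_inf[of "L \<inter> Q"] compact_attains_sup[of "L \<inter> Q"] False by metis
  obtain e1 where e1: "e1 > 0" "\<And>y. \<bar>y - m\<bar> < e1 \<Longrightarrow> y \<in> Q"
    using oQ mM(1) unfolding open_real by (metis IntD2)
  obtain e2 where e2: "e2 > 0" "\<And>y. \<bar>y - M\<bar> < e2 \<Longrightarrow> y \<in> Q"
    using oQ mM(2) unfolding open_real by (metis IntD2)
  define e where "e = min e1 e2 / 2"
  have e: "e > 0" "m - e \<in> Q" "M + e \<in> Q"
    using e1(1) e2(1) e1(2)[of "m - e"] e2(2)[of "M + e"] by (auto simp: e_def)
  have inQ: "x \<in> Q" if "m - e \<le> x" "x \<le> M + e" for x
    using iQ e(2,3) that unfolding is_interval_1 by blast
  have Xcases: "(Re z \<in> Q \<and> m \<le> Re z \<and> Re z \<le> M) \<or> (Re z \<notin> Q \<and> (Re z < m - e \<or> Re z > M + e))"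
    if "z \<in> X" for z
    using that mM(3)[of "Re z"] inQ[of "Re z"] QU unfolding X by force
  have "m \<le> M" using mM by blast
  have "hinf_approx X (\<lambda>z. (if Re z > m - e/2 then 1 else 0) - (if Re z > M + e/2 then 1 else 0))"
  proof (intro hinf_approx_diff hinf_approx_step[where \<delta>="e/2"])
    fix z assume "z \<in> X"
    from Xcases[OF this] show "e/2 \<le> \<bar>Re z - (m - e/2)\<bar>" "e/2 \<le> \<bar>Re z - (M + e/2)\<bar>"
      using e(1) \<open>m \<le> M\<close> by (auto simp: abs_if)
  qed (use e X in auto)
  then show ?thesis
  proof (rule hinf_approx_cong)
    fix z assume "z \<in> X"
    from Xcases[OF this] show "(if Re z > m - e/2 then 1 else 0) - (if Re z > M + e/2 then 1 else 0) =
        (if Re z \<in> Q then 1 else (0::complex))"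
      using e(1) \<open>m \<le> M\<close> by auto
  qed
qed

lemma hinf_approx_strips:
  fixes U L :: "real set"
  assumes L: "compact L" "L \<subseteq> U" and U: "open U"
    and X: "X = {z \<in> unit_disc. Re z \<in> L \<or> Re z \<notin> U}"
  shows "hinf_approx X (\<lambda>z. if Re z \<in> L then 1 else 0)"
proof -
  have "L \<subseteq> \<Union>(components U)" using L by (simp add: Union_components)
  then obtain C where C: "C \<subseteq> components U" "finite C" "L \<subseteq> \<Union>C"
    using compactE[OF L(1), of "components U"] open_components[OF U] by metis
  have "hinf_approx X (\<lambda>z. \<Sum>Q\<in>C. if Re z \<in> Q then 1 else 0)"
    using C(1) by (intro hinf_approx_sum hinf_approx_component[OF L U _ X]) auto
  then show ?thesis
  proof (rule hinf_approx_cong)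
    fix z assume z: "z \<in> X"
    show "(\<Sum>Q\<in>C. if Re z \<in> Q then 1 else 0) = (if Re z \<in> L then 1 else (0::complex))"
    proof (cases "Re z \<in> L")
      case True
      then obtain Q where Q: "Q \<in> C" "Re z \<in> Q" using C by blast
      have "Re z \<notin> Q'" if "Q' \<in> C" "Q' \<noteq> Q" for Q'
        using components_nonoverlap[of Q U Q'] Q that C(1) by blast
      then have "(\<Sum>Q'\<in>C. if Re z \<in> Q' then 1 else (0::complex)) = (\<Sum>Q'\<in>C. if Q' = Q then 1 else 0)"
        using Q by (intro sum.cong) auto
      then show ?thesis using True Q C(2) by simp
    next
      case False
      then have "Re z \<notin> U" using z by (auto simp: X)
      then have "\<And>Q. Q \<in> C \<Longrightarrow> Re z \<notin> Q" using C(1) in_components_subset by blast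
      then show ?thesis using False by simp
    qed
  qed
qed

section \<open>A degenerating Hamilton sequence\<close>

lemma integrable_AE_bounded_disc:
  fixes f :: "complex \<Rightarrow> 'b::{banach, second_countable_topology}"
  assumes "f \<in> borel_measurable disc_measure" "AE z in disc_measure. norm (f z) \<le> B"
  shows "integrable disc_measure f"
proof -
  have "emeasure disc_measure (space disc_measure) < \<infinity>"
    by (simp add: emeasure_restrict_space emeasure_bounded_finite[simplified])
  then show ?thesis
    using assms by (intro integrableI_bounded_set[where A="space disc_measure" and B=B]) auto
qed

lemma integrable_bounded_disc:
  fixes f :: "complex \<Rightarrow> 'b::{banach, second_countable_topology}"
  assumes "f \<in> borel_measurable disc_measure" "\<And>z. z \<in> unit_disc \<Longrightarrow> norm (f z) \<le> B"
  shows "integrable disc_measure f"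
  using assms by (intro integrable_AE_bounded_disc[where B=B] AE_I2) auto

lemma measurable_holomorphic_disc:
  "f holomorphic_on unit_disc \<Longrightarrow> f \<in> borel_measurable disc_measure"
  by (intro continuous_imp_measurable_on_sets_lebesgue holomorphic_on_imp_continuous_on) auto

lemma A_disc_bounded_holomorphic:
  assumes "f holomorphic_on unit_disc" "bounded (f ` unit_disc)"
  shows "f \<in> A_disc"
proof -
  obtain B where "\<And>z. z \<in> unit_disc \<Longrightarrow> norm (f z) \<le> B"
    using assms(2) unfolding bounded_iff by (metis imageI)
  then show ?thesis using assms(1)
    by (auto simp: A_disc_def intro!: integrable_bounded_disc measurable_holomorphic_disc)
qed

lemma measurable_Re_vimage:
  assumes "A \<in> sets borel"
  shows "{z. Re z \<in> A} \<in> sets borel"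
  using measurable_sets[OF borel_measurable_Re assms]
  by (simp add: vimage_def)

lemma measurable_Re_vimage_disc [measurable]:
  assumes "A \<in> sets borel"
  shows "Measurable.pred disc_measure (\<lambda>z. Re z \<in> A)"
proof -
  have "{z. Re z \<in> A} \<inter> unit_disc \<in> sets lebesgue"
    using measurable_Re_vimage[OF assms] by (simp add: sets.Int)
  moreover have "{z \<in> space disc_measure. Re z \<in> A} = {z. Re z \<in> A} \<inter> unit_disc" by auto
  ultimately show ?thesis by (simp add: pred_def sets_restrict_space_iff)
qed

lemma geometric_increments:
  fixes a :: "nat \<Rightarrow> complex"
  assumes "\<And>m. m \<ge> n \<Longrightarrow> cmod (a (Suc m) - a m) \<le> (1/2)^m"
  shows "convergent a" and "a \<longlonglongrightarrow> l \<Longrightarrow> cmod (a n - l) \<le> 2 * (1/2)^n"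
proof -
  have "summable (\<lambda>k. (1/2::real)^n * (1/2)^k)" by (intro summable_mult summable_geometric) simp
  then have "summable (\<lambda>k. a (Suc (n + k)) - a (n + k))"
    by (rule summable_comparison_test[rotated])
      (use assms in \<open>auto simp: power_add[symmetric]\<close>)
  then have "convergent (\<lambda>k. \<Sum>i<k. a (n + Suc i) - a (n + i))"
    by (simp add: summable_iff_convergent)
  moreover have "(\<Sum>i<k. a (n + Suc i) - a (n + i)) = a (n + k) - a n" for k
    using sum_lessThan_telescope[of "\<lambda>i. a (n + i)" k] by simp
  ultimately have "convergent (\<lambda>k. a (n + k) - a n)" by simp
  then have "convergent (\<lambda>k. (a (n + k) - a n) + a n)"
    by (intro convergent_add convergent_const)
  then have "convergent (\<lambda>k. a (k + n))" by (simp add: add.commute)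
  then show "convergent a" by (simp add: convergent_ignore_initial_segment)
next
  assume l: "a \<longlonglongrightarrow> l"
  have "cmod (a n - a (n + k)) \<le> 2 * (1/2)^n - 2 * (1/2)^(n + k)" for k
  proof (induction k)
    case (Suc k)
    have "cmod (a n - a (n + Suc k)) \<le> cmod (a n - a (n + k)) + cmod (a (Suc (n + k)) - a (n + k))"
      using norm_triangle_ineq[of "a n - a (n + k)" "a (n + k) - a (n + Suc k)"]
      by (simp add: norm_minus_commute)
    also have "\<dots> \<le> (2 * (1/2)^n - 2 * (1/2)^(n + k)) + (1/2)^(n + k)"
      using Suc assms by (intro add_mono) auto
    finally show ?case by simp
  qed simp
  then have "cmod (a n - a (n + k)) \<le> 2 * (1/2)^n" for k
    by (rule order_trans) simp
  moreover have "(\<lambda>k. cmod (a n - a (n + k))) \<longlonglongrightarrow> cmod (a n - l)"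
    using LIMSEQ_ignore_initial_segment[OF l, of n]
    by (intro tendsto_intros) (simp add: add.commute)
  ultimately show "cmod (a n - l) \<le> 2 * (1/2)^n" by (intro LIMSEQ_le_const2) auto
qed

lemma small_integral_rest:
  fixes U :: "real set" and L :: "nat \<Rightarrow> real set"
  assumes U: "open U" and L: "\<And>n. compact (L n)" "\<And>x. x \<in> U \<Longrightarrow> \<exists>N. \<forall>n\<ge>N. x \<in> L n"
    and f: "f \<in> A_disc" and "\<epsilon> > 0"
  obtains j where "j \<ge> j0" "(LINT z|disc_measure. indicator {z. Re z \<in> U - L j} z * cmod (f z)) \<le> \<epsilon>"
proof -
  have [measurable]: "U \<in> sets borel" "\<And>n. L n \<in> sets borel"
    using U L by (auto simp: borel_open borel_compact)
  have f': "integrable disc_measure f" using f by (simp add: A_disc_def)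
  have [measurable]: "f \<in> borel_measurable disc_measure"
    using f' by (rule borel_measurable_integrable)
  have "(\<lambda>n. LINT z|disc_measure. indicator {z. Re z \<in> U - L n} z * cmod (f z)) \<longlonglongrightarrow> (LINT z|disc_measure. 0)"
  proof (rule integral_dominated_convergence)
    show "integrable disc_measure (\<lambda>z. cmod (f z))" using f' by simp
    show "AE z in disc_measure. (\<lambda>n. indicator {z. Re z \<in> U - L n} z * cmod (f z)) \<longlonglongrightarrow> 0"
    proof (rule AE_I2)
      fix z
      have "\<forall>\<^sub>F n in sequentially. Re z \<notin> U - L n"
        using L(2)[of "Re z"] by (auto simp: eventually_sequentially)
      then show "(\<lambda>n. indicator {z. Re z \<in> U - L n} z * cmod (f z)) \<longlonglongrightarrow> 0"
        by (intro tendsto_eventually) (auto elim!: eventually_mono)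
    qed
    show "(\<lambda>z. indicator {z. Re z \<in> U - L n} z * cmod (f z)) \<in> borel_measurable disc_measure" for n
      unfolding indicator_def by measurable
    show "AE z in disc_measure. norm (indicator {z. Re z \<in> U - L n} z * cmod (f z)) \<le> cmod (f z)" for n
      by (auto simp: indicator_def)
  qed simp
  then have "\<forall>\<^sub>F n in sequentially. (LINT z|disc_measure. indicator {z. Re z \<in> U - L n} z * cmod (f z)) < \<epsilon>"
    using \<open>\<epsilon> > 0\<close> by (auto intro: order_tendstoD)
  then obtain N where "\<And>n. n \<ge> N \<Longrightarrow> (LINT z|disc_measure. indicator {z. Re z \<in> U - L n} z * cmod (f z)) < \<epsilon>"
    by (auto simp: eventually_sequentially)
  then show thesis by (intro that[of "max N j0"]) (auto intro: less_imp_le)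
qed

text \<open>One step of the inductive construction: \<open>exp (g - M T)\<close> is small off the strips and hardly differs from
  \<open>exp g\<close> over \<open>L\<close> (that is, for \<open>Re z \<in> L\<close>), when \<open>T\<close> is close to 1 off the strips and very close to 0 over \<open>L\<close>.\<close>
lemma degenerate_exponent:
  fixes U L :: "real set"
  assumes L: "compact L" "L \<subseteq> U" and U: "open U"
    and g: "g holomorphic_on unit_disc" "bounded (g ` unit_disc)"
  obtains g' where "g' holomorphic_on unit_disc" "bounded (g' ` unit_disc)"
    "\<And>z. z \<in> unit_disc \<Longrightarrow> Re z \<notin> U \<Longrightarrow> cmod (exp (g' z)) \<le> (1/2)^n"
    "\<And>z. z \<in> unit_disc \<Longrightarrow> Re z \<in> L \<Longrightarrow> cmod (g' z - g z) \<le> (1/2)^n"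
    "\<And>z. z \<in> unit_disc \<Longrightarrow> Re z \<in> L \<Longrightarrow> cmod (exp (g' z) - exp (g z)) \<le> (1/2)^n"
proof -
  obtain B where B: "B > 0" "\<And>z. z \<in> unit_disc \<Longrightarrow> cmod (g z) \<le> B"
    using g(2) unfolding bounded_pos by auto
  \<comment> \<open>Off the strips \<open>Re T \<ge> 1/2\<close>, so this \<open>M\<close> forces \<open>Re (g - M T) \<le> - n\<close>.\<close>
  define M where "M = 2 * (B + real n)"
  have "M > 0" using B by (simp add: M_def add_pos_nonneg)
  have "(exp \<longlongrightarrow> exp (0::complex)) (at 0)" by (intro tendsto_intros)
  then obtain d where d: "d > 0" "\<And>w::complex. w \<noteq> 0 \<Longrightarrow> cmod w < d \<Longrightarrow> cmod (exp w - 1) < (1/2)^n / exp B"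
    unfolding LIM_def by (metis dist_norm diff_zero divide_pos_pos exp_gt_zero exp_zero half_gt_zero_iff zero_less_one zero_less_power)
  define \<epsilon> where "\<epsilon> = min (1/2) (min (d / M) ((1/2)^n / M))"
  have \<epsilon>: "\<epsilon> > 0" "\<epsilon> \<le> 1/2" "M * \<epsilon> \<le> d" "M * \<epsilon> \<le> (1/2)^n"
  proof -
    show "\<epsilon> > 0" using d \<open>M > 0\<close> by (simp add: \<epsilon>_def)
    show "\<epsilon> \<le> 1/2" unfolding \<epsilon>_def by (rule min.cobounded1)
    have "\<epsilon> \<le> d / M" "\<epsilon> \<le> (1/2)^n / M" by (simp_all add: \<epsilon>_def)
    then show "M * \<epsilon> \<le> d" "M * \<epsilon> \<le> (1/2)^n"
      using \<open>M > 0\<close> by (simp_all add: pos_le_divide_eq mult.commute)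
  qed
  define X where "X = {z \<in> unit_disc. Re z \<in> L \<or> Re z \<notin> U}"
  have "hinf_approx X (\<lambda>z. 1 - (if Re z \<in> L then 1 else 0))"
    by (intro hinf_approx_diff hinf_approx_const hinf_approx_strips[OF L U]) (auto simp: X_def)
  then obtain T where T: "T holomorphic_on unit_disc" "bounded (T ` unit_disc)"
    "\<And>z. z \<in> X \<Longrightarrow> cmod (T z - (1 - (if Re z \<in> L then 1 else 0))) < \<epsilon>"
    using hinf_approxE \<epsilon>(1) by blast
  have T0: "cmod (M * T z) < M * \<epsilon>" if "z \<in> unit_disc" "Re z \<in> L" for z
  proof -
    have "cmod (T z) < \<epsilon>" using T(3)[of z] that by (simp add: X_def)
    then show ?thesis using \<open>M > 0\<close> by (simp add: norm_mult)
  qed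
  show thesis
  proof (rule that[of "\<lambda>z. g z - M * T z"])
    show "(\<lambda>z. g z - M * T z) holomorphic_on unit_disc"
      using g(1) T(1) by (intro holomorphic_intros)
    show "bounded ((\<lambda>z. g z - M * T z) ` unit_disc)"
      using g(2) T(2) by (intro bounded_minus_comp bounded_mult_image) (auto simp: image_constant_conv)
  next
    fix z assume z: "z \<in> unit_disc" "Re z \<notin> U"
    then have "Re z \<notin> L" using L(2) by blast
    then have "cmod (T z - 1) < \<epsilon>" using T(3)[of z] z by (simp add: X_def)
    then have "1/2 \<le> Re (T z)" using abs_Re_le_cmod[of "T z - 1"] \<epsilon>(2) by auto
    then have "M * (1/2) \<le> M * Re (T z)" using \<open>M > 0\<close> by (intro mult_left_mono) auto
    moreover have "Re (g z) \<le> B" using B(2)[OF z(1)] complex_Re_le_cmod[of "g z"] by linarith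
    ultimately have "Re (g z - M * T z) \<le> real n * (-1)" by (simp add: M_def)
    then have "cmod (exp (g z - M * T z)) \<le> exp (real n * (-1))" by (simp only: norm_exp_eq_Re exp_le_cancel_iff)
    also have "\<dots> = exp (-1) ^ n" by (rule exp_of_nat_mult)
    also have "\<dots> \<le> (1/2) ^ n"
      using exp_ge_add_one_self[of 1] by (intro power_mono) (auto simp: exp_minus field_simps)
    finally show "cmod (exp (g z - M * T z)) \<le> (1/2)^n" .
  next
    fix z assume z: "z \<in> unit_disc" "Re z \<in> L"
    have T0': "cmod (- (M * T z)) < M * \<epsilon>" using T0[OF z] by simp
    then show "cmod (g z - M * T z - g z) \<le> (1/2)^n" using \<epsilon>(4) by simp
    have "cmod (exp (- (M * T z)) - 1) \<le> (1/2)^n / exp B"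
      using d(2)[of "- (M * T z)"] T0' \<epsilon>(3) by (cases "M * T z = 0") auto
    moreover have "cmod (exp (g z)) \<le> exp B"
      using B(2)[OF z(1)] complex_Re_le_cmod[of "g z"] by simp
    ultimately have "cmod (exp (g z)) * cmod (exp (- (M * T z)) - 1) \<le> exp B * ((1/2)^n / exp B)"
      by (intro mult_mono) auto
    moreover have "exp (g z - M * T z) - exp (g z) = exp (g z) * (exp (- (M * T z)) - 1)"
      by (simp add: exp_diff exp_minus field_simps)
    ultimately show "cmod (exp (g z - M * T z) - exp (g z)) \<le> (1/2)^n" by (simp add: norm_mult)
  qed
qed

text \<open>The sequence \<open>\<phi> n\<close> tends to 0 off the strips and to the zero-free function \<open>\<phi>\<^sub>0\<close> on the strips.  The limit
  is uniform up to the remainder \<open>R n\<close>, where \<open>\<phi> n\<close> is uncontrolled but has small mass.  Working with exponentials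
  is what makes \<open>\<phi>\<^sub>0\<close> free of zeros.\<close>
proposition degenerating_sequence:
  fixes U :: "real set"
  assumes U: "open U"
  obtains \<phi> :: "nat \<Rightarrow> complex \<Rightarrow> complex" and \<phi>\<^sub>0 :: "complex \<Rightarrow> complex" and R :: "nat \<Rightarrow> real set"
  where "\<And>n. \<phi> n \<in> A_disc"
    "\<And>n. R n \<in> sets borel"
    "\<And>z. z \<in> unit_disc \<Longrightarrow> Re z \<in> U \<Longrightarrow> \<phi>\<^sub>0 z \<noteq> 0"
    "\<And>z. z \<in> unit_disc \<Longrightarrow> Re z \<in> U \<Longrightarrow> (\<lambda>n. \<phi> n z) \<longlonglongrightarrow> \<phi>\<^sub>0 z"
    "\<And>n z. z \<in> unit_disc \<Longrightarrow> Re z \<notin> U \<Longrightarrow> cmod (\<phi> n z) \<le> (1/2)^n"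
    "\<And>n z. z \<in> unit_disc \<Longrightarrow> Re z \<in> U - R n \<Longrightarrow> cmod (\<phi> n z - \<phi>\<^sub>0 z) \<le> 2 * (1/2)^n"
    "\<And>n. (LINT z|disc_measure. indicator {z. Re z \<in> R n} z * cmod (\<phi> n z)) \<le> (1/2)^n"
proof -
  obtain L where L: "\<And>n. compact (L n)" "\<And>n. L n \<subseteq> U" "\<And>n. L n \<subseteq> interior (L (Suc n))"
      "\<Union>(range L) = U"
    using open_Union_compact_subsets[OF U] by metis
  have "L n \<subseteq> L (Suc n)" for n using L(3) interior_subset by blast
  then have mono: "L m \<subseteq> L n" if "m \<le> n" for m n using that by (rule lift_Suc_mono_le)
  have exh: "\<exists>N. \<forall>n\<ge>N. x \<in> L n" if "x \<in> U" for x
    using that mono L(4) by (metis UN_E subsetD)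
  \<comment> \<open>A state is an exponent \<open>g\<close> with an index \<open>j\<close> such that \<open>L j\<close> carries almost all of the mass of
    \<open>exp g\<close> on the strips; the next exponent may differ from \<open>g\<close> only little over \<open>L j\<close>.\<close>
  define P where "P n s \<longleftrightarrow> (let g = fst s; j = snd s in g holomorphic_on unit_disc \<and> bounded (g ` unit_disc)
      \<and> (\<forall>z\<in>unit_disc. Re z \<notin> U \<longrightarrow> cmod (exp (g z)) \<le> (1/2)^n)
      \<and> (LINT z|disc_measure. indicator {z. Re z \<in> U - L j} z * cmod (exp (g z))) \<le> (1/2)^n)"
    for n and s :: "(complex \<Rightarrow> complex) \<times> nat"
  define Q where "Q n s s' \<longleftrightarrow> snd s < snd s' \<and> (\<forall>z\<in>unit_disc. Re z \<in> L (snd s) \<longrightarrow>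
      cmod (fst s' z - fst s z) \<le> (1/2)^n \<and> cmod (exp (fst s' z) - exp (fst s z)) \<le> (1/2)^n)"
    for n :: nat and s s' :: "(complex \<Rightarrow> complex) \<times> nat"
  have expA: "(\<lambda>z. exp (g z)) \<in> A_disc" if g: "g holomorphic_on unit_disc" "bounded (g ` unit_disc)" for g
  proof (rule A_disc_bounded_holomorphic)
    show "(\<lambda>z. exp (g z)) holomorphic_on unit_disc" using g by (intro holomorphic_intros)
    obtain B where B: "\<And>z. z \<in> unit_disc \<Longrightarrow> cmod (g z) \<le> B"
      using g(2) unfolding bounded_iff by (metis imageI)
    have "cmod (exp (g z)) \<le> exp B" if "z \<in> unit_disc" for z
      using B[OF that] complex_Re_le_cmod[of "g z"] by simp
    then show "bounded ((\<lambda>z. exp (g z)) ` unit_disc)" unfolding bounded_iff by blast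
  qed
  have "\<exists>f. \<forall>n. P n (f n) \<and> Q n (f n) (f (Suc n))"
  proof (rule dependent_nat_choice)
    have 0: "(\<lambda>z. 0) holomorphic_on unit_disc" "bounded ((\<lambda>z. 0::complex) ` unit_disc)"
      by (auto simp: image_constant_conv)
    obtain j where "(LINT z|disc_measure. indicator {z. Re z \<in> U - L j} z * cmod (exp 0)) \<le> 1"
      using small_integral_rest[OF U L(1) exh expA[OF 0], of 1 0] by auto
    then show "\<exists>s. P 0 s" using 0 by (intro exI[of _ "(\<lambda>z. 0, j)"]) (simp add: P_def)
  next
    fix s n assume P: "P n s"
    obtain g j where s: "s = (g, j)" by (cases s)
    have g: "g holomorphic_on unit_disc" "bounded (g ` unit_disc)" using P by (auto simp: P_def s)
    obtain T where T: "T holomorphic_on unit_disc" "bounded (T ` unit_disc)"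
      "\<And>z. z \<in> unit_disc \<Longrightarrow> Re z \<notin> U \<Longrightarrow> cmod (exp (T z)) \<le> (1/2)^Suc n"
      "\<And>z. z \<in> unit_disc \<Longrightarrow> Re z \<in> L j \<Longrightarrow> cmod (T z - g z) \<le> (1/2)^Suc n"
      "\<And>z. z \<in> unit_disc \<Longrightarrow> Re z \<in> L j \<Longrightarrow> cmod (exp (T z) - exp (g z)) \<le> (1/2)^Suc n"
      using degenerate_exponent[OF L(1,2) U g, of "Suc n"] by metis
    obtain j' where j': "j' \<ge> Suc j"
      "(LINT z|disc_measure. indicator {z. Re z \<in> U - L j'} z * cmod (exp (T z))) \<le> (1/2)^Suc n"
      using small_integral_rest[OF U L(1) exh expA[OF T(1,2)], of "(1/2)^Suc n" "Suc j"] by auto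
    have half: "(1/2)^Suc n \<le> (1/2::real)^n" by simp
    have "P (Suc n) (T, j')" using T j' by (simp add: P_def)
    moreover have "Q n s (T, j')"
      using j'(1) order_trans[OF T(4) half] order_trans[OF T(5) half] by (simp add: Q_def s)
    ultimately show "\<exists>s'. P (Suc n) s' \<and> Q n s s'" by blast
  qed
  then obtain f where f: "\<And>n. P n (f n)" "\<And>n. Q n (f n) (f (Suc n))" by blast
  define g where "g n = fst (f n)" for n
  define j where "j n = snd (f n)" for n
  have g: "g n holomorphic_on unit_disc" "bounded (g n ` unit_disc)"
    "z \<in> unit_disc \<Longrightarrow> Re z \<notin> U \<Longrightarrow> cmod (exp (g n z)) \<le> (1/2)^n"
    "(LINT z|disc_measure. indicator {z. Re z \<in> U - L (j n)} z * cmod (exp (g n z))) \<le> (1/2)^n" for n z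
    using f(1)[of n] by (auto simp: P_def g_def j_def Let_def)
  have incr: "cmod (g (Suc n) z - g n z) \<le> (1/2)^n" "cmod (exp (g (Suc n) z) - exp (g n z)) \<le> (1/2)^n"
    if "z \<in> unit_disc" "Re z \<in> L (j n)" for n z
    using f(2)[of n] that by (auto simp: Q_def g_def j_def)
  have "j n < j (Suc n)" for n using f(2)[of n] by (simp add: Q_def j_def)
  then have smj: "strict_mono j" by (rule strict_monoI_Suc)
  have inL: "Re z \<in> L (j m)" if "Re z \<in> L (j n)" "n \<le> m" for z m n
    using mono[of "j n" "j m"] smj that by (auto simp: strict_mono_less_eq)
  define \<gamma> where "\<gamma> z = lim (\<lambda>n. g n z)" for z
  have lim: "(\<lambda>n. g n z) \<longlonglongrightarrow> \<gamma> z" if z: "z \<in> unit_disc" "Re z \<in> U" for z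
  proof -
    obtain N where N: "\<And>n. n \<ge> N \<Longrightarrow> Re z \<in> L n" using exh[OF z(2)] by blast
    have "Re z \<in> L (j m)" if "m \<ge> N" for m
      using N seq_suble[OF smj, of m] that by simp
    then have "convergent (\<lambda>n. g n z)"
      using incr(1)[OF z(1)] by (intro geometric_increments(1)[of N]) auto
    then show ?thesis unfolding \<gamma>_def by (rule convergent_LIMSEQ_iff[THEN iffD1])
  qed
  have limexp: "(\<lambda>n. exp (g n z)) \<longlonglongrightarrow> exp (\<gamma> z)" if "z \<in> unit_disc" "Re z \<in> U" for z
    by (intro tendsto_exp lim that)
  show thesis
  proof (rule that[of "\<lambda>n z. exp (g n z)" "\<lambda>n. U - L (j n)" "\<lambda>z. exp (\<gamma> z)"])
    show "(\<lambda>z. exp (g n z)) \<in> A_disc" for n by (rule expA[OF g(1,2)])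
    show "U - L (j n) \<in> sets borel" for n
      using borel_open[OF U] borel_compact[OF L(1)] by (rule sets.Diff)
    show "exp (\<gamma> z) \<noteq> 0" for z by simp
    show "(\<lambda>n. exp (g n z)) \<longlonglongrightarrow> exp (\<gamma> z)" if "z \<in> unit_disc" "Re z \<in> U" for z
      by (rule limexp[OF that])
    show "cmod (exp (g n z)) \<le> (1/2)^n" if "z \<in> unit_disc" "Re z \<notin> U" for n z
      by (rule g(3)[OF that])
    show "(LINT z|disc_measure. indicator {z. Re z \<in> U - L (j n)} z * cmod (exp (g n z))) \<le> (1/2)^n" for n
      by (rule g(4))
    show "cmod (exp (g n z) - exp (\<gamma> z)) \<le> 2 * (1/2)^n"
      if z: "z \<in> unit_disc" "Re z \<in> U - (U - L (j n))" for n z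
    proof (rule geometric_increments(2)[of n "\<lambda>n. exp (g n z)"])
      have zL: "Re z \<in> L (j n)" using z(2) by blast
      show "cmod (exp (g (Suc m) z) - exp (g m z)) \<le> (1/2)^m" if "m \<ge> n" for m
        by (rule incr(2)[OF z(1) inL[OF zL that]])
      show "(\<lambda>n. exp (g n z)) \<longlonglongrightarrow> exp (\<gamma> z)" using limexp z by blast
    qed
  qed
qed

section \<open>A coefficient that is forced on vertical strips\<close>

lemma phase_mult:
  assumes "w \<noteq> 0"
  shows "of_real k * cnj w / of_real (cmod w) * w = of_real (k * cmod w)"
proof -
  have "cnj w * w = of_real (cmod w) * of_real (cmod w)"
    by (simp add: complex_norm_square[symmetric] power2_eq_square mult.commute)
  then show ?thesis using assms by (simp add: mult.assoc)
qed

lemma phase_determined: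
  assumes "w \<noteq> 0" "cmod v \<le> k" "k * cmod w \<le> Re (v * w)"
  shows "v = of_real k * cnj w / of_real (cmod w)"
proof -
  have "cmod (v * w) \<le> k * cmod w" using assms(2) by (simp add: norm_mult mult_right_mono)
  moreover have "Re (v * w) \<le> cmod (v * w)" by (rule complex_Re_le_cmod)
  ultimately have e: "Re (v * w) = cmod (v * w)" "cmod (v * w) = k * cmod w" using assms(3) by auto
  then have "Im (v * w) = 0" using cmod_eq_Re[of "v * w"] cmod_power2[of "v * w"] by simp
  then have "v * w = of_real (k * cmod w)" using e by (simp add: complex_eq_iff)
  also have "\<dots> = (of_real k * cnj w / of_real (cmod w)) * w"
    using phase_mult[OF assms(1)] by simp
  finally show ?thesis by (rule mult_right_cancel[THEN iffD1, OF assms(1)])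
qed

text \<open>For \<open>|\<kappa>| \<le> k\<close> the integrand is nonnegative and vanishes exactly where \<open>\<kappa> \<phi> = k |\<phi>|\<close>; its
  integral only depends on the class of \<open>\<kappa>\<close>.\<close>
lemma hamilton_defect:
  assumes "\<kappa> \<in> Linf_disc" "\<phi> \<in> A_disc"
  shows "integrable disc_measure (\<lambda>z. k * cmod (\<phi> z) - Re (\<kappa> z * \<phi> z))"
    and "(LINT z|disc_measure. k * cmod (\<phi> z) - Re (\<kappa> z * \<phi> z)) =
      k * (LINT z|disc_measure. cmod (\<phi> z)) - Re (LINT z|disc_measure. \<kappa> z * \<phi> z)"
proof -
  have 1: "integrable disc_measure (\<lambda>z. k * cmod (\<phi> z))" using assms(2) by (simp add: A_disc_def)
  have 2: "integrable disc_measure (\<lambda>z. Re (\<kappa> z * \<phi> z))"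
    by (rule integrable_Re[OF integrable_Linf_mult[OF assms]])
  show "integrable disc_measure (\<lambda>z. k * cmod (\<phi> z) - Re (\<kappa> z * \<phi> z))"
    by (rule Bochner_Integration.integrable_diff[OF 1 2])
  have "(LINT z|disc_measure. Re (\<kappa> z * \<phi> z)) = Re (LINT z|disc_measure. \<kappa> z * \<phi> z)"
    by (rule integral_Re[OF integrable_Linf_mult[OF assms]])
  then show "(LINT z|disc_measure. k * cmod (\<phi> z) - Re (\<kappa> z * \<phi> z)) =
      k * (LINT z|disc_measure. cmod (\<phi> z)) - Re (LINT z|disc_measure. \<kappa> z * \<phi> z)"
    unfolding Bochner_Integration.integral_diff[OF 1 2] by simp
qed

text \<open>The coefficient is \<open>k\<close> times the conjugate phase of \<open>\<phi>\<^sub>0\<close> on the strips and 0 elsewhere.  Its defect against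
  \<open>\<phi> n\<close> tends to 0; the same is then true for every \<open>\<nu>\<close> of its class with \<open>|\<nu>| \<le> k\<close>, and Fatou's lemma
  gives the phase of \<open>\<nu>\<close> on the strips.\<close>
proposition forced_coefficient:
  fixes U :: "real set" and k :: real
  assumes U: "open U" and "k > 0"
  obtains \<mu> where "\<mu> \<in> borel_measurable disc_measure"
    "\<And>z. z \<in> unit_disc \<Longrightarrow> Re z \<in> U \<Longrightarrow> cmod (\<mu> z) = k"
    "\<And>z. Re z \<notin> U \<Longrightarrow> \<mu> z = 0"
    "\<And>\<nu>. \<nu> \<in> Linf_disc \<Longrightarrow> inf_equivalent \<nu> \<mu> \<Longrightarrow> AE z in disc_measure. cmod (\<nu> z) \<le> k \<Longrightarrow>
       AE z in disc_measure. Re z \<in> U \<longrightarrow> \<nu> z = \<mu> z"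
proof -
  obtain \<phi> \<phi>\<^sub>0 R where \<phi>: "\<And>n. \<phi> n \<in> A_disc"
    and R[measurable]: "\<And>n. R n \<in> sets borel"
    and \<phi>\<^sub>0: "\<And>z. z \<in> unit_disc \<Longrightarrow> Re z \<in> U \<Longrightarrow> \<phi>\<^sub>0 z \<noteq> 0"
    and lim: "\<And>z. z \<in> unit_disc \<Longrightarrow> Re z \<in> U \<Longrightarrow> (\<lambda>n. \<phi> n z) \<longlonglongrightarrow> \<phi>\<^sub>0 z"
    and off: "\<And>n z. z \<in> unit_disc \<Longrightarrow> Re z \<notin> U \<Longrightarrow> cmod (\<phi> n z) \<le> (1/2)^n"
    and close: "\<And>n z. z \<in> unit_disc \<Longrightarrow> Re z \<in> U - R n \<Longrightarrow> cmod (\<phi> n z - \<phi>\<^sub>0 z) \<le> 2 * (1/2)^n"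
    and rest: "\<And>n. (LINT z|disc_measure. indicator {z. Re z \<in> R n} z * cmod (\<phi> n z)) \<le> (1/2)^n"
    by (rule degenerating_sequence[OF U], rule that)
  have int\<phi>: "integrable disc_measure (\<phi> n)" for n using \<phi> by (simp add: A_disc_def)
  have [measurable]: "\<phi> n \<in> borel_measurable disc_measure" for n
    using int\<phi> by (rule borel_measurable_integrable)
  have [measurable]: "U \<in> sets borel" using U by simp
  define \<psi> where "\<psi> z = (if Re z \<in> U then \<phi>\<^sub>0 z else 0)" for z
  \<comment> \<open>Where \<open>\<psi>\<close> vanishes, the quotient is 0.\<close>
  define \<mu> where "\<mu> z = of_real k * cnj (\<psi> z) / of_real (cmod (\<psi> z))" for z
  have [measurable]: "\<psi> \<in> borel_measurable disc_measure"
  proof (rule borel_measurable_LIMSEQ_metric)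
    show "(\<lambda>z. if Re z \<in> U then \<phi> n z else 0) \<in> borel_measurable disc_measure" for n by measurable
    show "(\<lambda>n. if Re z \<in> U then \<phi> n z else 0) \<longlonglongrightarrow> \<psi> z" if "z \<in> space disc_measure" for z
      using lim[of z] that by (auto simp: \<psi>_def)
  qed
  have [measurable]: "cnj \<in> borel_measurable borel" "complex_of_real \<in> borel_measurable borel"
    by (intro borel_measurable_continuous_onI continuous_intros)+
  have meas: "\<mu> \<in> borel_measurable disc_measure" unfolding \<mu>_def by measurable
  have on: "cmod (\<mu> z) = k" if "z \<in> unit_disc" "Re z \<in> U" for z
    using \<phi>\<^sub>0[OF that] that \<open>k > 0\<close> by (simp add: \<mu>_def \<psi>_def norm_mult norm_divide)
  have zero: "\<mu> z = 0" if "Re z \<notin> U" for z using that by (simp add: \<mu>_def \<psi>_def)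
  have le: "cmod (\<mu> z) \<le> k" if "z \<in> unit_disc" for z
    using on[OF that] zero[of z] \<open>k > 0\<close> by (cases "Re z \<in> U") auto
  have \<mu>L: "\<mu> \<in> Linf_disc" using le by (intro Linf_disc_I meas AE_I2) auto
  define A where "A = measure disc_measure (space disc_measure)"
  have int1: "integrable disc_measure (\<lambda>z. c)" for c :: real
    by (rule integrable_bounded_disc[where B="\<bar>c\<bar>"]) auto
  have int2: "integrable disc_measure (\<lambda>z. indicator {z. Re z \<in> R n} z * cmod (\<phi> n z))" for n
  proof (rule Bochner_Integration.integrable_bound)
    show "integrable disc_measure (\<lambda>z. cmod (\<phi> n z))" using int\<phi> by simp
    show "(\<lambda>z. indicator {z. Re z \<in> R n} z * cmod (\<phi> n z)) \<in> borel_measurable disc_measure"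
      unfolding indicator_def by measurable
  qed (auto simp: indicator_def)
  have pointwise: "k * cmod (\<phi> n z) - Re (\<mu> z * \<phi> n z)
      \<le> 4 * k * (1/2)^n + 2 * k * (indicator {z. Re z \<in> R n} z * cmod (\<phi> n z))"
    if z: "z \<in> unit_disc" for n z
  proof -
    have c: "k * cmod (\<phi> n z) - Re (\<mu> z * \<phi> n z) \<le> 2 * k * cmod (\<phi> n z)"
    proof -
      have "- Re (\<mu> z * \<phi> n z) \<le> cmod (\<mu> z * \<phi> n z)" using abs_Re_le_cmod[of "\<mu> z * \<phi> n z"] by linarith
      also have "\<dots> \<le> k * cmod (\<phi> n z)" using le[OF z] by (simp add: norm_mult mult_right_mono)
      finally show ?thesis by simp
    qed
    have p: "0 \<le> 4 * k * (1/2)^n" using \<open>k > 0\<close> by simp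
    consider "Re z \<in> R n" | "Re z \<notin> R n" "Re z \<notin> U" | "Re z \<in> U - R n" by blast
    then show ?thesis
    proof cases
      case 1
      then show ?thesis using c p by simp
    next
      case 2
      then have "k * cmod (\<phi> n z) \<le> k * (1/2)^n" using off[OF z] \<open>k > 0\<close> by simp
      also have "\<dots> \<le> 4 * k * (1/2)^n" using \<open>k > 0\<close> by simp
      finally show ?thesis using 2 by (simp add: zero)
    next
      case 3
      have "\<mu> z * \<phi>\<^sub>0 z = of_real (k * cmod (\<phi>\<^sub>0 z))"
        using 3 phase_mult[OF \<phi>\<^sub>0[OF z]] by (simp add: \<mu>_def \<psi>_def del: times_divide_eq_left)
      then have "k * cmod (\<phi> n z) - Re (\<mu> z * \<phi> n z) =
          k * (cmod (\<phi> n z) - cmod (\<phi>\<^sub>0 z)) - Re (\<mu> z * (\<phi> n z - \<phi>\<^sub>0 z))"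
        by (simp add: right_diff_distrib)
      also have "\<dots> \<le> k * cmod (\<phi> n z - \<phi>\<^sub>0 z) + k * cmod (\<phi> n z - \<phi>\<^sub>0 z)"
      proof -
        have "k * (cmod (\<phi> n z) - cmod (\<phi>\<^sub>0 z)) \<le> k * cmod (\<phi> n z - \<phi>\<^sub>0 z)"
          using \<open>k > 0\<close> norm_triangle_ineq2[of "\<phi> n z" "\<phi>\<^sub>0 z"] by (intro mult_left_mono) auto
        moreover have "- Re (\<mu> z * (\<phi> n z - \<phi>\<^sub>0 z)) \<le> k * cmod (\<phi> n z - \<phi>\<^sub>0 z)"
          using abs_Re_le_cmod[of "\<mu> z * (\<phi> n z - \<phi>\<^sub>0 z)"]
            mult_right_mono[OF le[OF z], of "cmod (\<phi> n z - \<phi>\<^sub>0 z)"]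
          unfolding norm_mult by simp
        ultimately show ?thesis by linarith
      qed
      also have "\<dots> \<le> 4 * k * (1/2)^n"
        using mult_left_mono[OF close[OF z 3], of k] \<open>k > 0\<close> by simp
      finally show ?thesis using 3 by simp
    qed
  qed
  have forced: "AE z in disc_measure. Re z \<in> U \<longrightarrow> \<nu> z = \<mu> z"
    if \<nu>: "\<nu> \<in> Linf_disc" "inf_equivalent \<nu> \<mu>" "AE z in disc_measure. cmod (\<nu> z) \<le> k" for \<nu>
  proof -
    have [measurable]: "\<nu> \<in> borel_measurable disc_measure" using \<nu>(1) by (simp add: Linf_disc_def)
    define f where "f n z = k * cmod (\<phi> n z) - Re (\<nu> z * \<phi> n z)" for n z
    have intf: "integrable disc_measure (\<lambda>z. k * cmod (\<phi> n z) - Re (\<kappa> z * \<phi> n z))" if "\<kappa> \<in> Linf_disc" for \<kappa> n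
      by (rule hamilton_defect(1)[OF that \<phi>])
    have f0: "AE z in disc_measure. 0 \<le> f n z" for n
      using \<nu>(3)
    proof eventually_elim
      case (elim z)
      have "Re (\<nu> z * \<phi> n z) \<le> cmod (\<nu> z) * cmod (\<phi> n z)"
        using complex_Re_le_cmod[of "\<nu> z * \<phi> n z"] by (simp add: norm_mult)
      also have "\<dots> \<le> k * cmod (\<phi> n z)" using elim by (simp add: mult_right_mono)
      finally show ?case by (simp add: f_def)
    qed
    have fint: "(LINT z|disc_measure. f n z) \<le> (4 * k * A + 2 * k) * (1/2)^n" for n
    proof -
      have "(LINT z|disc_measure. f n z) = k * (LINT z|disc_measure. cmod (\<phi> n z)) - Re (LINT z|disc_measure. \<nu> z * \<phi> n z)"
        unfolding f_def by (rule hamilton_defect(2)[OF \<nu>(1) \<phi>])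
      also have "(LINT z|disc_measure. \<nu> z * \<phi> n z) = (LINT z|disc_measure. \<mu> z * \<phi> n z)"
        using \<nu>(2) \<phi> by (simp add: inf_equivalent_def)
      also have "k * (LINT z|disc_measure. cmod (\<phi> n z)) - Re (LINT z|disc_measure. \<mu> z * \<phi> n z)
          = (LINT z|disc_measure. k * cmod (\<phi> n z) - Re (\<mu> z * \<phi> n z))"
        by (rule hamilton_defect(2)[OF \<mu>L \<phi>, symmetric])
      also have "\<dots> \<le> (LINT z|disc_measure. 4 * k * (1/2)^n + 2 * k * (indicator {z. Re z \<in> R n} z * cmod (\<phi> n z)))"
        by (intro integral_mono intf \<mu>L Bochner_Integration.integrable_add int1 integrable_mult_right int2 pointwise) simp
      also have "\<dots> = 4 * k * (1/2)^n * A + 2 * k * (LINT z|disc_measure. indicator {z. Re z \<in> R n} z * cmod (\<phi> n z))"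
        using int1 int2 by (subst Bochner_Integration.integral_add) (auto simp: A_def)
      also have "\<dots> \<le> 4 * k * (1/2)^n * A + 2 * k * (1/2)^n"
        using rest[of n] \<open>k > 0\<close> by simp
      finally show ?thesis by (simp add: algebra_simps)
    qed
    have "(\<integral>\<^sup>+z. liminf (\<lambda>n. ennreal (f n z)) \<partial>disc_measure) \<le> liminf (\<lambda>n. \<integral>\<^sup>+z. ennreal (f n z) \<partial>disc_measure)"
      unfolding f_def by (intro nn_integral_liminf) measurable
    also have "\<dots> = 0"
    proof -
      have eq: "(\<integral>\<^sup>+z. ennreal (f n z) \<partial>disc_measure) = ennreal (LINT z|disc_measure. f n z)" for n
        using intf[OF \<nu>(1)] f0 by (intro nn_integral_eq_integral) (auto simp: f_def)
      have "(\<lambda>n. LINT z|disc_measure. f n z) \<longlonglongrightarrow> 0"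
      proof (rule tendsto_sandwich[where f="\<lambda>n. 0"])
        show "(\<lambda>n. (4 * k * A + 2 * k) * (1/2)^n) \<longlonglongrightarrow> 0"
          by (intro tendsto_mult_right_zero LIMSEQ_power_zero) simp
        show "\<forall>\<^sub>F n in sequentially. 0 \<le> (LINT z|disc_measure. f n z)"
          by (simp add: integral_nonneg_AE[OF f0])
      qed (use fint in auto)
      then have "(\<lambda>n. ennreal (LINT z|disc_measure. f n z)) \<longlonglongrightarrow> ennreal 0"
        by (rule tendsto_ennrealI)
      then show ?thesis unfolding eq by (simp add: lim_imp_Liminf)
    qed
    finally have "(\<integral>\<^sup>+z. liminf (\<lambda>n. ennreal (f n z)) \<partial>disc_measure) = 0" by simp
    then have "AE z in disc_measure. liminf (\<lambda>n. ennreal (f n z)) = 0"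
      unfolding f_def by (subst (asm) nn_integral_0_iff_AE) measurable
    moreover have "AE z in disc_measure. z \<in> unit_disc"
      by (rule AE_I2) simp
    ultimately show ?thesis using \<nu>(3)
    proof eventually_elim
      case (elim z)
      show ?case
      proof
        assume zU: "Re z \<in> U"
        have "(\<lambda>n. f n z) \<longlonglongrightarrow> k * cmod (\<phi>\<^sub>0 z) - Re (\<nu> z * \<phi>\<^sub>0 z)"
          unfolding f_def by (intro tendsto_intros lim elim zU)
        then have "(\<lambda>n. ennreal (f n z)) \<longlonglongrightarrow> ennreal (k * cmod (\<phi>\<^sub>0 z) - Re (\<nu> z * \<phi>\<^sub>0 z))"
          by (rule tendsto_ennrealI)
        then have "ennreal (k * cmod (\<phi>\<^sub>0 z) - Re (\<nu> z * \<phi>\<^sub>0 z)) = 0"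
          using elim(1) by (simp add: lim_imp_Liminf)
        then have "k * cmod (\<phi>\<^sub>0 z) \<le> Re (\<nu> z * \<phi>\<^sub>0 z)" by (simp add: ennreal_eq_0_iff)
        then have "\<nu> z = of_real k * cnj (\<phi>\<^sub>0 z) / of_real (cmod (\<phi>\<^sub>0 z))"
          by (intro phase_determined \<phi>\<^sub>0 elim zU)
        then show "\<nu> z = \<mu> z" using zU by (simp add: \<mu>_def \<psi>_def)
      qed
    qed
  qed
  show thesis using meas on zero forced by (rule that)
qed

section \<open>Annihilators supported off the strips\<close>

lemma AE_zero_if_orthogonal_continuous:
  fixes h :: "complex \<Rightarrow> complex"
  assumes h: "h \<in> borel_measurable disc_measure" and "c > 0"
    and hc: "AE z in disc_measure. cmod (h z) \<le> c"
    and orth: "\<And>g. continuous_on UNIV g \<Longrightarrow> (LINT z|disc_measure. h z * g z) = 0"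
  shows "AE z in disc_measure. h z = 0"
proof -
  have "h measurable_on unit_disc" using h by (simp add: measurable_on_iff_borel_measurable)
  then obtain N g where N: "negligible N" and g: "\<And>n. continuous_on UNIV (g n)"
    and lim: "\<And>z. z \<notin> N \<Longrightarrow> (\<lambda>n. g n z) \<longlonglongrightarrow> (if z \<in> unit_disc then h z else 0)"
    unfolding measurable_on_def by blast
  have "N \<in> null_sets lebesgue" using N by (simp add: negligible_iff_null_sets)
  then have "AE z in lebesgue. z \<notin> N" by (rule AE_not_in)
  then have NN: "AE z in disc_measure. z \<in> unit_disc \<and> z \<notin> N" 
    by (auto simp: AE_restrict_space_iff elim!: eventually_mono)
  have h[measurable]: "h \<in> borel_measurable disc_measure" by (rule h)
  have [measurable]: "cnj \<in> borel_measurable borel"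
    by (intro borel_measurable_continuous_onI continuous_intros)
  \<comment> \<open>Truncation makes dominated convergence applicable and does not disturb the limit.\<close>
  define \<tau> where "\<tau> w = (c / max c (cmod w)) *\<^sub>R w" for w :: complex
  have pos: "max c (cmod w) > 0" for w :: complex using \<open>c > 0\<close> by (simp add: less_max_iff_disj)
  have cont\<tau>: "continuous_on UNIV \<tau>"
    unfolding \<tau>_def using pos by (intro continuous_intros) (auto simp: less_imp_neq[symmetric])
  have \<tau>le: "cmod (\<tau> w) \<le> c" for w
  proof -
    have "cmod (\<tau> w) = c * (cmod w / max c (cmod w))"
      using \<open>c > 0\<close> by (simp add: \<tau>_def)
    also have "\<dots> \<le> c * 1"
      using pos[of w] \<open>c > 0\<close> by (intro mult_left_mono) (auto simp: divide_le_eq_1)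
    finally show ?thesis by simp
  qed
  have \<tau>id: "\<tau> w = w" if "cmod w \<le> c" for w
    using that \<open>c > 0\<close> by (simp add: \<tau>_def max_absorb1)
  define G where "G n z = cnj (\<tau> (g n z))" for n z
  have contG: "continuous_on UNIV (G n)" for n
  proof -
    have "continuous_on UNIV (\<tau> \<circ> g n)"
      using g cont\<tau> by (intro continuous_on_compose) (auto intro: continuous_on_subset)
    then show ?thesis unfolding G_def comp_def by (intro continuous_intros)
  qed
  have [measurable]: "G n \<in> borel_measurable disc_measure" for n
    by (intro continuous_imp_measurable_on_sets_lebesgue) (auto intro: continuous_on_subset[OF contG])
  have "(\<lambda>n. LINT z|disc_measure. h z * G n z) \<longlonglongrightarrow> (LINT z|disc_measure. h z * cnj (h z))"
  proof (rule integral_dominated_convergence)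
    show "integrable disc_measure (\<lambda>z. c * c)" by (rule integrable_bounded_disc[where B="c * c"]) (use \<open>c > 0\<close> in auto)
    show "AE z in disc_measure. (\<lambda>n. h z * G n z) \<longlonglongrightarrow> h z * cnj (h z)"
      using NN hc
    proof eventually_elim
      case (elim z)
      have "(\<lambda>n. g n z) \<longlonglongrightarrow> h z" using lim[of z] elim by simp
      then have "(\<lambda>n. \<tau> (g n z)) \<longlonglongrightarrow> \<tau> (h z)"
        using continuous_on_tendsto_compose[OF cont\<tau>] by auto
      then show ?case unfolding G_def using \<tau>id[of "h z"] elim by (intro tendsto_intros) auto
    qed
    show "AE z in disc_measure. norm (h z * G n z) \<le> c * c" for n
      using hc
    proof eventually_elim
      case (elim z)
      then show ?case unfolding norm_mult using \<tau>le[of "g n z"] \<open>c > 0\<close>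
        by (intro mult_mono) (auto simp: G_def)
    qed
  qed measurable
  then have "(LINT z|disc_measure. h z * cnj (h z)) = 0"
    by (simp add: orth contG LIMSEQ_const_iff)
  moreover have "h z * cnj (h z) = of_real ((cmod (h z))^2)" for z
    by (rule complex_norm_square[symmetric])
  ultimately have "(LINT z|disc_measure. complex_of_real ((cmod (h z))^2)) = 0" by simp
  then have 0: "(LINT z|disc_measure. (cmod (h z))^2) = 0"
    by (simp only: integral_complex_of_real of_real_eq_0_iff)
  have int: "integrable disc_measure (\<lambda>z. (cmod (h z))^2)"
  proof (rule integrable_AE_bounded_disc[where B="c^2"])
    show "AE z in disc_measure. norm ((cmod (h z))^2) \<le> c^2"
      using hc by eventually_elim (auto intro!: power_mono)
  qed measurable
  have "AE z in disc_measure. (cmod (h z))^2 = 0"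
    using integral_nonneg_eq_0_iff_AE[OF int] 0 by simp
  then show ?thesis by eventually_elim simp
qed

lemma hinf_approx_annihilated:
  assumes h: "h \<in> Linf_disc" "\<And>\<phi>. \<phi> \<in> A_disc \<Longrightarrow> (LINT z|disc_measure. h z * \<phi> z) = 0"
    and supp: "AE z in disc_measure. z \<notin> X \<longrightarrow> h z = 0"
    and X: "X \<subseteq> unit_disc" and g: "hinf_approx X g" and gm: "g \<in> borel_measurable disc_measure"
  shows "(LINT z|disc_measure. h z * g z) = 0"
proof -
  have hm[measurable]: "h \<in> borel_measurable disc_measure" using h(1) by (simp add: Linf_disc_def)
  have gm[measurable]: "g \<in> borel_measurable disc_measure" by (rule gm)
  obtain c where c: "c \<ge> 0" "AE z in disc_measure. cmod (h z) \<le> c"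
    using Linf_disc_AE_bound[OF h(1)] by metis
  obtain B where B: "B > 0" "\<And>z. z \<in> X \<Longrightarrow> cmod (g z) \<le> B"
    using hinf_approx_bounded[OF g X] by metis
  have int: "integrable disc_measure (\<lambda>z. h z * g z)"
  proof (rule integrable_AE_bounded_disc[where B="c * B"])
    show "AE z in disc_measure. norm (h z * g z) \<le> c * B"
      using c(2) supp
    proof eventually_elim
      case (elim z)
      show ?case
      proof (cases "z \<in> X")
        case True
        then show ?thesis unfolding norm_mult using elim B c(1) by (intro mult_mono) auto
      next
        case False
        then show ?thesis using elim c(1) B(1) by simp
      qed
    qed
  qed measurable
  define A where "A = measure disc_measure (space disc_measure)"
  have "cmod (LINT z|disc_measure. h z * g z) \<le> \<epsilon> * (c * A)" if \<epsilon>: "\<epsilon> > 0" for \<epsilon>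
  proof -
    obtain f where f: "f holomorphic_on unit_disc" "bounded (f ` unit_disc)"
      "\<And>z. z \<in> X \<Longrightarrow> cmod (f z - g z) < \<epsilon>"
      using hinf_approxE[OF g \<epsilon>] by blast
    have fA: "f \<in> A_disc" by (rule A_disc_bounded_holomorphic[OF f(1,2)])
    have "(LINT z|disc_measure. h z * g z) = (LINT z|disc_measure. h z * g z - h z * f z)"
      using int integrable_Linf_mult[OF h(1) fA] h(2)[OF fA] by simp
    also have "cmod \<dots> \<le> (LINT z|disc_measure. c * \<epsilon>)"
    proof (rule order_trans[OF integral_norm_bound integral_mono_AE])
      show "integrable disc_measure (\<lambda>z. c * \<epsilon>)"
        by (rule integrable_bounded_disc[where B="\<bar>c * \<epsilon>\<bar>"]) auto
      show "integrable disc_measure (\<lambda>z. cmod (h z * g z - h z * f z))"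
        using int integrable_Linf_mult[OF h(1) fA] by (intro integrable_norm Bochner_Integration.integrable_diff)
      show "AE z in disc_measure. cmod (h z * g z - h z * f z) \<le> c * \<epsilon>"
        using c(2) supp
      proof eventually_elim
        case (elim z)
        show ?case
        proof (cases "z \<in> X")
          case True
          have "cmod (h z * g z - h z * f z) = cmod (h z) * cmod (f z - g z)"
            by (simp add: right_diff_distrib[symmetric] norm_mult norm_minus_commute)
          also have "\<dots> \<le> c * \<epsilon>" using elim f(3)[OF True] c(1) by (intro mult_mono) auto
          finally show ?thesis .
        next
          case False
          then show ?thesis using elim c(1) \<epsilon> by simp
        qed
      qed
    qed
    also have "\<dots> = \<epsilon> * (c * A)" by (simp add: A_def)
    finally show ?thesis .
  qed
  note bound = this
  have "((\<lambda>\<epsilon>. \<epsilon> * (c * A)) \<longlongrightarrow> 0 * (c * A)) (at_right 0)" by (intro tendsto_intros)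
  then have "cmod (LINT z|disc_measure. h z * g z) \<le> 0 * (c * A)"
    by (rule tendsto_lowerbound) (auto simp: eventually_at_right_less bound eventually_mono[OF eventually_at_right_less])
  then show ?thesis by simp
qed

text \<open>On the set \<open>X\<close>, the ramp is a uniform limit of sums of steps with jumps in \<open>U\<close>: one jump of size \<open>1/m\<close> in each
  interval \<open>(i/m, (i+1)/m)\<close>.\<close>
lemma hinf_approx_ramp:
  fixes U :: "real set"
  assumes U: "open U" "0 \<in> U" and dense: "\<And>a b. 0 \<le> a \<Longrightarrow> a < b \<Longrightarrow> b \<le> 1 \<Longrightarrow> \<exists>t\<in>U. a < t \<and> t < b"
    and X: "X = {z \<in> unit_disc. Re z \<notin> U}"
  shows "hinf_approx X (\<lambda>z. of_real (max 0 (Re z)))"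
proof (rule hinf_approx_uniform_limit)
  fix \<epsilon> :: real assume "\<epsilon> > 0"
  then obtain m where m: "m > 0" "inverse (real m) < \<epsilon>"
    using ex_inverse_of_nat_less by blast
  have "\<exists>t\<in>U. real i / m < t \<and> t < real (Suc i) / m" if "i < m" for i
    using that m by (intro dense) (auto simp: divide_simps)
  then obtain t where t: "\<And>i. i < m \<Longrightarrow> t i \<in> U" "\<And>i. i < m \<Longrightarrow> real i / m < t i"
    "\<And>i. i < m \<Longrightarrow> t i < real (Suc i) / m" by metis
  have step: "hinf_approx X (\<lambda>z. if Re z > s then 1 else 0)" if "s \<in> U" for s
  proof -
    obtain e where e: "e > 0" "\<And>y. \<bar>y - s\<bar> < e \<Longrightarrow> y \<in> U"
      using U(1) \<open>s \<in> U\<close> unfolding open_real by metis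
    have "e \<le> \<bar>Re z - s\<bar>" if "z \<in> X" for z using e(2)[of "Re z"] that by (force simp: X)
    then show ?thesis using e(1) by (intro hinf_approx_step[of X e]) (auto simp: X)
  qed
  define f :: "complex \<Rightarrow> complex" where "f z = (1 / of_nat m) * (\<Sum>i<m. if Re z > t i then 1 else 0)" for z
  have "hinf_approx X f"
    unfolding f_def using t(1) by (intro hinf_approx_cmult hinf_approx_sum step) (auto simp: X)
  moreover have "cmod (f z - of_real (max 0 (Re z))) \<le> \<epsilon>" if z: "z \<in> X" for z
  proof -
    define x where "x = Re z"
    have x1: "x < 1" using z abs_Re_le_cmod[of z] by (auto simp: X x_def)
    define S where "S = {i. i < m \<and> x > t i}"
    have finS: "finite S" by (simp add: S_def)
    have "(\<Sum>i<m. if x > t i then 1 else (0::complex)) = of_nat (card S)"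
      by (simp add: S_def sum.If_cases Int_def)
    then have fz: "f z = of_real (card S / m)" by (simp add: f_def x_def)
    have S: "real (card S) \<le> m * max 0 x + 1 \<and> m * max 0 x \<le> real (card S) + 1"
    proof (cases "x > 0")
      case False
      have "S = {}"
      proof (rule ccontr)
        assume "S \<noteq> {}"
        then obtain i where "i < m" "t i < x" by (auto simp: S_def)
        moreover have "0 \<le> real i / m" by simp
        ultimately show False using t(2)[of i] False by linarith
      qed
      then show ?thesis using False by simp
    next
      case True
      define q where "q = nat \<lfloor>m * x\<rfloor>"
      have q: "real q \<le> m * x" "m * x < real q + 1"
        using True m(1) by (auto simp: q_def)
      have "real m * x < real m * 1" using x1 m(1) by (intro mult_strict_left_mono) auto
      then have "q < m" using q(1) by simp
      have "{..<q} \<subseteq> S"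
      proof
        fix i assume "i \<in> {..<q}"
        then have "i < m" "real (Suc i) \<le> m * x" using \<open>q < m\<close> q(1) by auto
        then have "real (Suc i) / m \<le> x" using m(1) by (simp add: field_simps)
        then show "i \<in> S" using t(3)[OF \<open>i < m\<close>] \<open>i < m\<close> by (simp add: S_def)
      qed
      then have "card {..<q} \<le> card S" by (rule card_mono[OF finS])
      then have "q \<le> card S" by simp
      have "S \<subseteq> {..<Suc q}"
      proof
        fix i assume "i \<in> S"
        then have "real i / m < x" "i < m" using t(2)[of i] by (auto simp: S_def)
        then have "real i < m * x" using m(1) by (simp add: field_simps)
        then show "i \<in> {..<Suc q}" using q(2) by simp
      qed
      then have "card S \<le> Suc q" using card_mono[of "{..<Suc q}" S] by simp
      then show ?thesis using \<open>q \<le> card S\<close> q True by simp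
    qed
    have "\<bar>card S / m - max 0 x\<bar> = \<bar>card S - m * max 0 x\<bar> / m"
      using m(1) by (simp add: field_simps abs_mult abs_divide diff_divide_distrib[symmetric])
    also have "\<dots> \<le> 1 / m" using S by (intro divide_right_mono) auto
    finally have "\<bar>card S / m - max 0 x\<bar> \<le> \<epsilon>" using m(2) by (simp add: inverse_eq_divide)
    moreover have "f z - of_real (max 0 (Re z)) = of_real (card S / m - max 0 x)"
      by (simp only: fz x_def of_real_diff)
    ultimately show ?thesis by (simp only: norm_of_real)
  qed
  ultimately show "\<exists>f. hinf_approx X f \<and> (\<forall>z\<in>X. cmod (f z - of_real (max 0 (Re z))) \<le> \<epsilon>)" by blast
qed

text \<open>On the part of \<open>X\<close> in the right half plane both \<open>z\<close> and \<open>Re z\<close> are approximable, hence all real polynomials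
  in \<open>Re z\<close> and \<open>Im z\<close> are, and by the Stone--Weierstrass theorem all continuous functions.\<close>
lemma hinf_approx_continuous_right_half:
  fixes U :: "real set" and g :: "complex \<Rightarrow> complex"
  assumes U: "open U" "0 \<in> U" and dense: "\<And>a b. 0 \<le> a \<Longrightarrow> a < b \<Longrightarrow> b \<le> 1 \<Longrightarrow> \<exists>t\<in>U. a < t \<and> t < b"
    and X: "X = {z \<in> unit_disc. Re z \<notin> U}" and g: "continuous_on UNIV g"
  shows "hinf_approx X (\<lambda>z. if Re z > 0 then g z else 0)"
proof -
  have Xd: "X \<subseteq> unit_disc" by (auto simp: X)
  have ramp: "hinf_approx X (\<lambda>z. of_real (max 0 (Re z)))" by (rule hinf_approx_ramp[OF U dense X])
  have one: "hinf_approx X (\<lambda>z. if Re z > 0 then 1 else 0)"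
  proof -
    obtain e where e: "e > 0" "\<And>y. \<bar>y - 0\<bar> < e \<Longrightarrow> y \<in> U"
      using U unfolding open_real by metis
    have "e \<le> \<bar>Re z - 0\<bar>" if "z \<in> X" for z using e(2)[of "Re z"] that by (force simp: X)
    then show ?thesis using e(1) Xd by (intro hinf_approx_step[of X e])
  qed
  have x: "hinf_approx X (\<lambda>z. if Re z > 0 then of_real (Re z) else 0)"
    using ramp by (rule hinf_approx_cong) auto
  have y: "hinf_approx X (\<lambda>z. if Re z > 0 then of_real (Im z) else 0)"
  proof -
    have "hinf_approx X (\<lambda>z. (- \<i>) * (z * (if Re z > 0 then 1 else 0) - (if Re z > 0 then of_real (Re z) else 0)))"
      by (intro hinf_approx_cmult hinf_approx_diff hinf_approx_mult hinf_approx_id one x Xd)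
    then show ?thesis by (rule hinf_approx_cong) (auto simp: complex_eq_iff)
  qed
  have poly: "hinf_approx X (\<lambda>z. if Re z > 0 then of_real (p z) else 0)" if "real_polynomial_function p" for p
    using that
  proof (induction p rule: real_polynomial_function.induct)
    case (linear f)
    interpret bounded_linear f by (rule linear)
    have f: "f z = Re z * f 1 + Im z * f \<i>" for z
    proof -
      have "z = Re z *\<^sub>R 1 + Im z *\<^sub>R \<i>" by (simp add: complex_eq_iff)
      then have "f z = f (Re z *\<^sub>R 1 + Im z *\<^sub>R \<i>)" by (rule arg_cong)
      also have "\<dots> = Re z * f 1 + Im z * f \<i>" by (simp only: add scaleR real_scaleR_def)
      finally show ?thesis .
    qed
    have "hinf_approx X (\<lambda>z. of_real (f 1) * (if Re z > 0 then of_real (Re z) else 0)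
        + of_real (f \<i>) * (if Re z > 0 then of_real (Im z) else 0))"
      by (intro hinf_approx_add hinf_approx_cmult x y Xd)
    then show ?case
    proof (rule hinf_approx_cong)
      fix z
      show "of_real (f 1) * (if Re z > 0 then of_real (Re z) else 0)
        + of_real (f \<i>) * (if Re z > 0 then of_real (Im z) else 0) =
        (if Re z > 0 then complex_of_real (f z) else 0)"
        by (subst f[of z]) (simp add: mult.commute)
    qed
  next
    case (const c)
    show ?case by (rule hinf_approx_cong[OF hinf_approx_cmult[OF Xd one, of "of_real c"]]) auto
  next
    case (add p q)
    show ?case by (rule hinf_approx_cong[OF hinf_approx_add[OF add.IH]]) auto
  next
    case (mult p q)
    show ?case by (rule hinf_approx_cong[OF hinf_approx_mult[OF Xd mult.IH]]) auto
  qed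
  have real: "hinf_approx X (\<lambda>z. if Re z > 0 then of_real (f z) else 0)" if f: "continuous_on UNIV f" for f :: "complex \<Rightarrow> real"
  proof (rule hinf_approx_uniform_limit)
    fix \<epsilon> :: real assume "\<epsilon> > 0"
    obtain p where p: "real_polynomial_function p" "\<And>z. z \<in> cball 0 1 \<Longrightarrow> \<bar>f z - p z\<bar> < \<epsilon>"
      using Stone_Weierstrass_real_polynomial_function[OF compact_cball continuous_on_subset[OF f] \<open>\<epsilon> > 0\<close>]
      by (metis subset_UNIV)
    have "cmod ((if Re z > 0 then of_real (p z) else 0) - (if Re z > 0 then of_real (f z) else 0)) \<le> \<epsilon>" if "z \<in> X" for z
    proof -
      have "\<bar>f z - p z\<bar> < \<epsilon>" using that Xd by (intro p(2)) auto
      moreover have "cmod (of_real (p z) - of_real (f z)) = \<bar>f z - p z\<bar>"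
        unfolding of_real_diff[symmetric] norm_of_real by simp
      ultimately show ?thesis using \<open>\<epsilon> > 0\<close> by simp
    qed
    then show "\<exists>h. hinf_approx X h \<and> (\<forall>z\<in>X. cmod (h z - (if Re z > 0 then of_real (f z) else 0)) \<le> \<epsilon>)"
      using poly[OF p(1)] by (intro exI[of _ "\<lambda>z. if Re z > 0 then of_real (p z) else 0"]) auto
  qed
  have "hinf_approx X (\<lambda>z. (if Re z > 0 then of_real (Re (g z)) else 0) + \<i> * (if Re z > 0 then of_real (Im (g z)) else 0))"
    by (intro hinf_approx_add hinf_approx_cmult real Xd continuous_on_Re continuous_on_Im g)
  then show ?thesis by (rule hinf_approx_cong) (auto simp: complex_eq_iff)
qed

proposition annihilator_zero_right_half:
  fixes U :: "real set"
  assumes U: "open U" "0 \<in> U" and dense: "\<And>a b. 0 \<le> a \<Longrightarrow> a < b \<Longrightarrow> b \<le> 1 \<Longrightarrow> \<exists>t\<in>U. a < t \<and> t < b"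
    and h: "h \<in> Linf_disc" "\<And>\<phi>. \<phi> \<in> A_disc \<Longrightarrow> (LINT z|disc_measure. h z * \<phi> z) = 0"
    and supp: "AE z in disc_measure. Re z \<in> U \<longrightarrow> h z = 0"
  shows "AE z in disc_measure. Re z > 0 \<longrightarrow> h z = 0"
proof -
  define X where "X = {z \<in> unit_disc. Re z \<notin> U}"
  have hm[measurable]: "h \<in> borel_measurable disc_measure" using h(1) by (simp add: Linf_disc_def)
  have pos[measurable]: "Measurable.pred disc_measure (\<lambda>z. Re z > 0)"
    using measurable_Re_vimage_disc[of "{0<..}"] by simp
  obtain c where c: "c \<ge> 0" "AE z in disc_measure. cmod (h z) \<le> c"
    using Linf_disc_AE_bound[OF h(1)] by metis
  have "AE z in disc_measure. (if Re z > 0 then h z else 0) = 0"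
  proof (rule AE_zero_if_orthogonal_continuous[where c="c + 1"])
    show "(\<lambda>z. if Re z > 0 then h z else 0) \<in> borel_measurable disc_measure" by measurable
    show "AE z in disc_measure. cmod (if Re z > 0 then h z else 0) \<le> c + 1"
      using c(2) by eventually_elim (use c(1) in auto)
    fix g :: "complex \<Rightarrow> complex" assume g: "continuous_on UNIV g"
    have gm[measurable]: "g \<in> borel_measurable disc_measure"
      by (intro continuous_imp_measurable_on_sets_lebesgue) (auto intro: continuous_on_subset[OF g])
    have "(LINT z|disc_measure. h z * (if Re z > 0 then g z else 0)) = 0"
    proof (rule hinf_approx_annihilated[OF h])
      show "AE z in disc_measure. z \<notin> X \<longrightarrow> h z = 0"
        using supp AE_space by eventually_elim (auto simp: X_def)
      show "hinf_approx X (\<lambda>z. if Re z > 0 then g z else 0)"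
        by (rule hinf_approx_continuous_right_half[OF U dense X_def g])
    qed (auto simp: X_def)
    moreover have "h z * (if Re z > 0 then g z else 0) = (if Re z > 0 then h z else 0) * g z" for z
      by simp
    ultimately show "(LINT z|disc_measure. (if Re z > 0 then h z else 0) * g z) = 0" by simp
  qed (use c in auto)
  then show ?thesis by eventually_elim (auto split: if_splits)
qed

section \<open>A compactly supported annihilator\<close>

lemma has_field_derivative_max0_square:
  "((\<lambda>x::real. (max 0 x)^2) has_real_derivative 2 * max 0 x) (at x)"
proof -
  consider "x > 0" | "x < 0" | "x = 0" by linarith
  then show ?thesis
  proof cases
    case 1
    have "((\<lambda>x. x^2) has_real_derivative 2 * max 0 x) (at x)"
      using 1 by (auto intro!: derivative_eq_intros)
    then show ?thesis
      by (rule has_field_derivative_transform_within_open[where S="{0<..}"]) (use 1 in auto)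
  next
    case 2
    have "((\<lambda>x. 0) has_real_derivative 2 * max 0 x) (at x)"
      using 2 by (auto intro!: derivative_eq_intros)
    then show ?thesis
      by (rule has_field_derivative_transform_within_open[where S="{..<0}"]) (use 2 in auto)
  next
    case 3
    have "((\<lambda>h::real. ((max 0 (0 + h))^2 - (max 0 0)^2) / h) \<longlongrightarrow> 0) (at 0)"
    proof (rule Lim_null_comparison)
      show "((\<lambda>h::real. \<bar>h\<bar>) \<longlongrightarrow> 0) (at 0)" by (intro tendsto_eq_intros) auto
      show "\<forall>\<^sub>F h in at 0. norm (((max 0 (0 + h))^2 - (max 0 0)^2) / h) \<le> \<bar>h::real\<bar>"
        by (intro always_eventually allI) (auto simp: max_def power2_eq_square)
    qed
    then show ?thesis unfolding DERIV_def 3 by simp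
  qed
qed

text \<open>Translation invariance of area: the integral of a directional derivative of a compactly
  supported Lipschitz function vanishes.\<close>
lemma integral_directional_derivative_eq_0:
  fixes F D :: "complex \<Rightarrow> complex"
  assumes lip: "\<And>x y. cmod (F x - F y) \<le> L * cmod (x - y)"
    and supp: "\<And>z. z \<notin> cball a R \<Longrightarrow> F z = 0"
    and der: "\<And>z. ((\<lambda>t. (F (z + of_real t * e) - F z) / of_real t) \<longlongrightarrow> D z) (at_right 0)"
    and e: "cmod e \<le> 1"
  shows "integrable lborel D" "(LINT z|lborel. D z) = 0"
proof -
  have "L \<ge> 0" using order_trans[OF norm_ge_zero lip[of 1 0]] by simp
  have contF: "continuous_on UNIV F"
  proof (rule lipschitz_on_continuous_on)
    show "L-lipschitz_on UNIV F"
      using lip \<open>L \<ge> 0\<close> by (intro lipschitz_onI) (auto simp: dist_norm)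
  qed
  have [measurable]: "F \<in> borel_measurable borel" using contF by (rule borel_measurable_continuous_onI)
  have intF: "integrable lborel F"
  proof -
    have "integrable lborel (\<lambda>z. indicator (cball a R) z *\<^sub>R F z)"
      by (intro borel_integrable_compact continuous_on_subset[OF contF]) auto
    moreover have "indicator (cball a R) z *\<^sub>R F z = F z" for z
      using supp by (auto simp: indicator_def)
    ultimately show ?thesis by simp
  qed
  have shift: "integrable lborel (\<lambda>z. F (z + c))" "(LINT z|lborel. F (z + c)) = (LINT z|lborel. F z)" for c
  proof -
    have [measurable]: "(+) c \<in> borel_measurable borel"
      by (intro borel_measurable_continuous_onI continuous_intros)
    have "integrable (distr lborel borel ((+) c)) F" using intF by (simp add: lborel_distr_plus)
    then show "integrable lborel (\<lambda>z. F (z + c))"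
      by (subst (asm) integrable_distr_eq) (simp_all add: add.commute)
    have "(LINT z|lborel. F z) = (LINT z|distr lborel borel ((+) c). F z)" by (simp add: lborel_distr_plus)
    also have "\<dots> = (LINT z|lborel. F (c + z))" by (subst integral_distr) simp_all
    finally show "(LINT z|lborel. F (z + c)) = (LINT z|lborel. F z)" by (simp add: add.commute)
  qed
  define t where "t n = inverse (real (Suc n))" for n
  have t: "t n > 0" "t n \<le> 1" for n by (auto simp: t_def divide_simps)
  define Q where "Q n z = (F (z + of_real (t n) * e) - F z) / of_real (t n)" for n z
  have limQ: "(\<lambda>n. Q n z) \<longlonglongrightarrow> D z" for z
  proof -
    have "filterlim t (at_right 0) sequentially"
      unfolding t_def using LIMSEQ_inverse_real_of_nat
      by (auto simp: filterlim_at intro!: always_eventually)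
    then show ?thesis unfolding Q_def by (rule filterlim_compose[OF der])
  qed
  have Qm[measurable]: "Q n \<in> borel_measurable borel" for n
  proof -
    have "continuous_on UNIV (\<lambda>z. F (z + of_real (t n) * e))"
      by (rule continuous_on_compose2[OF contF]) (auto intro!: continuous_intros)
    then have [measurable]: "(\<lambda>z. F (z + of_real (t n) * e)) \<in> borel_measurable borel"
      by (rule borel_measurable_continuous_onI)
    show ?thesis unfolding Q_def by measurable
  qed
  have Dm[measurable]: "D \<in> borel_measurable lborel"
    by (rule borel_measurable_LIMSEQ_metric[where f=Q]) (use limQ in simp_all)
  have dom: "integrable lborel (\<lambda>z. indicator (cball a (R + 1)) z *\<^sub>R L)"
    by (intro borel_integrable_compact continuous_intros) auto
  have bound: "norm (Q n z) \<le> indicator (cball a (R + 1)) z *\<^sub>R L" for n z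
  proof (cases "z \<in> cball a (R + 1)")
    case True
    have "cmod (F (z + of_real (t n) * e) - F z) \<le> L * (t n * cmod e)"
      using lip[of "z + of_real (t n) * e" z] t[of n] by (simp add: norm_mult)
    also have "\<dots> \<le> L * (t n * 1)"
      using \<open>L \<ge> 0\<close> e t[of n] by (intro mult_left_mono) auto
    finally show ?thesis using True t[of n] by (simp add: Q_def norm_divide divide_simps)
  next
    case False
    have "cmod (of_real (t n) * e) \<le> 1"
      using t[of n] e by (simp add: norm_mult mult_le_one)
    then have "z \<notin> cball a R" "z + of_real (t n) * e \<notin> cball a R"
      using False norm_triangle_ineq[of "z + of_real (t n) * e - a" "- (of_real (t n) * e)"]
      by (auto simp: dist_norm norm_minus_commute)
    then show ?thesis using False supp by (simp add: Q_def)
  qed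
  have "(\<lambda>n. LINT z|lborel. Q n z) \<longlonglongrightarrow> (LINT z|lborel. D z)"
    by (rule integral_dominated_convergence[where s=Q, OF Dm _ dom]) (use limQ bound in auto)
  moreover have "(LINT z|lborel. Q n z) = 0" for n
    unfolding Q_def using shift intF by simp
  ultimately show "(LINT z|lborel. D z) = 0" by (simp add: LIMSEQ_const_iff)
  show "integrable lborel D"
    by (rule integrable_dominated_convergence[where s=Q, OF Dm _ dom]) (use limQ bound in auto)
qed

text \<open>The factor in front of \<open>\<phi> z\<close> is a multiple of the d-bar derivative of the bump
  \<open>(max 0 (r\<^sup>2 - |z - c|\<^sup>2))\<^sup>2\<close>, so this is Green's formula for that bump.\<close>
proposition annihilator_bump:
  assumes "r > 0" and sub: "cball c r \<subseteq> unit_disc" and \<phi>: "\<phi> \<in> A_disc"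
  shows "(LINT z|disc_measure. (of_real (max 0 (r^2 - (cmod (z - c))^2)) * (z - c)) * \<phi> z) = 0"
proof -
  define P where "P z = max 0 (r^2 - (cmod (z - c))^2)" for z
  define F where "F z = (if z \<in> unit_disc then of_real ((P z)^2) * \<phi> z else 0)" for z
  define F' where "F' z v = (if z \<in> unit_disc then of_real (2 * P z * (- 2 * (v \<bullet> (z - c)))) * \<phi> z
      + of_real ((P z)^2) * (deriv \<phi> z * v) else 0)" for z v
  have hol: "\<phi> holomorphic_on unit_disc" using \<phi> by (simp add: A_disc_def)
  have P0: "P z = 0" if "z \<notin> cball c r" for z
  proof -
    have "r^2 \<le> (cmod (z - c))^2" using that \<open>r > 0\<close> by (intro power_mono) (auto simp: dist_norm norm_minus_commute)
    then show ?thesis by (simp add: P_def)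
  qed
  have Pbound: "0 \<le> P z" "P z \<le> r^2" for z by (auto simp: P_def)
  have der: "(F has_derivative F' z) (at z)" for z
  proof (cases "z \<in> unit_disc")
    case True
    have 1: "((\<lambda>z. r^2 - (cmod (z - c))^2) has_derivative (\<lambda>v. - 2 * (v \<bullet> (z - c)))) (at z)"
      unfolding power2_norm_eq_inner
      by (rule has_derivative_eq_rhs) (auto intro!: derivative_eq_intros simp: inner_commute)
    have 2: "((\<lambda>z. (P z)^2) has_derivative (\<lambda>v. 2 * P z * (- 2 * (v \<bullet> (z - c))))) (at z)"
      using has_derivative_compose[OF 1 has_field_derivative_max0_square[unfolded has_field_derivative_def]]
      unfolding P_def by (simp add: mult.commute mult.left_commute)
    have 3: "(\<phi> has_derivative (\<lambda>v. deriv \<phi> z * v)) (at z)"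
      using holomorphic_derivI[OF hol _ True] by (simp add: has_field_derivative_def)
    have "((\<lambda>z. of_real ((P z)^2) * \<phi> z) has_derivative
        (\<lambda>v. of_real ((P z)^2) * (deriv \<phi> z * v) + of_real (2 * P z * (- 2 * (v \<bullet> (z - c)))) * \<phi> z)) (at z)"
      by (rule has_derivative_mult[OF has_derivative_of_real[OF 2] 3])
    then have "(F has_derivative
        (\<lambda>v. of_real ((P z)^2) * (deriv \<phi> z * v) + of_real (2 * P z * (- 2 * (v \<bullet> (z - c)))) * \<phi> z)) (at z)"
      by (rule has_derivative_transform_within_open[where s=unit_disc]) (use True in \<open>auto simp: F_def\<close>)
    moreover have "F' z = (\<lambda>v. of_real ((P z)^2) * (deriv \<phi> z * v) + of_real (2 * P z * (- 2 * (v \<bullet> (z - c)))) * \<phi> z)"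
      using True by (auto simp: F'_def fun_eq_iff)
    ultimately show ?thesis by simp
  next
    case False
    then have z: "z \<in> - cball c r" using sub by blast
    have "F' z = (\<lambda>v. 0)" using False by (simp add: F'_def fun_eq_iff)
    then have "((\<lambda>z. 0) has_derivative F' z) (at z)" by simp
    then show ?thesis
      by (rule has_derivative_transform_within_open[where s="- cball c r"])
        (use z P0 in \<open>auto simp: F_def open_Compl\<close>)
  qed
  obtain B where B: "B > 0" "\<And>z. z \<in> cball c r \<Longrightarrow> cmod (\<phi> z) \<le> B"
  proof -
    have "bounded (\<phi> ` cball c r)"
      using sub by (intro compact_imp_bounded compact_continuous_image holomorphic_on_imp_continuous_on holomorphic_on_subset[OF hol]) auto
    then show thesis using that unfolding bounded_pos by auto
  qed
  obtain B' where B': "B' > 0" "\<And>z. z \<in> cball c r \<Longrightarrow> cmod (deriv \<phi> z) \<le> B'"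
  proof -
    have "deriv \<phi> holomorphic_on unit_disc" using hol by (intro holomorphic_deriv) auto
    then have "bounded (deriv \<phi> ` cball c r)"
      using sub by (intro compact_imp_bounded compact_continuous_image holomorphic_on_imp_continuous_on) (auto intro: holomorphic_on_subset)
    then show thesis using that unfolding bounded_pos by auto
  qed
  define L where "L = 2 * r^2 * (2 * r) * B + (r^2)^2 * B'"
  have "L > 0" using B B' \<open>r > 0\<close> by (simp add: L_def add_pos_pos)
  have F'bound: "cmod (F' z v) \<le> L * cmod v" for z v
  proof (cases "z \<in> cball c r")
    case True
    then have zd: "z \<in> unit_disc" and zr: "cmod (z - c) \<le> r" using sub by (auto simp: dist_norm norm_minus_commute)
    have "\<bar>2 * P z * (- 2 * (v \<bullet> (z - c)))\<bar> = 2 * P z * (2 * \<bar>v \<bullet> (z - c)\<bar>)"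
      using Pbound by (simp add: abs_mult)
    also have "\<dots> \<le> 2 * r^2 * (2 * (cmod v * r))"
      using Pbound[of z] zr order_trans[OF Cauchy_Schwarz_ineq2[of v "z - c"] mult_left_mono[OF zr norm_ge_zero[of v]]]
      by (intro mult_mono) auto
    finally have 1: "\<bar>2 * P z * (- 2 * (v \<bullet> (z - c)))\<bar> \<le> 2 * r^2 * (2 * (cmod v * r))" .
    have "cmod (F' z v) \<le> \<bar>2 * P z * (- 2 * (v \<bullet> (z - c)))\<bar> * cmod (\<phi> z) + (P z)^2 * (cmod (deriv \<phi> z) * cmod v)"
    proof -
      have "F' z v = of_real (2 * P z * (- 2 * (v \<bullet> (z - c)))) * \<phi> z + of_real ((P z)^2) * (deriv \<phi> z * v)"
        using zd by (simp only: F'_def if_True)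
      then show ?thesis
        using norm_triangle_ineq[of "of_real (2 * P z * (- 2 * (v \<bullet> (z - c)))) * \<phi> z" "of_real ((P z)^2) * (deriv \<phi> z * v)"]
        unfolding norm_mult norm_of_real by simp
    qed
    also have "\<dots> \<le> 2 * r^2 * (2 * (cmod v * r)) * B + (r^2)^2 * (B' * cmod v)"
      using 1 B(1) B(2)[OF True] B'(1) B'(2)[OF True] Pbound[of z] \<open>r > 0\<close>
      by (intro add_mono mult_mono power_mono) auto
    also have "\<dots> = L * cmod v" by (simp add: L_def algebra_simps)
    finally show ?thesis .
  next
    case False
    then show ?thesis using P0[OF False] \<open>L > 0\<close> by (simp add: F'_def)
  qed
  have lip: "cmod (F x - F y) \<le> L * cmod (x - y)" for x y
    by (rule differentiable_bound[where S=UNIV and f'=F'])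
      (use der F'bound in \<open>auto intro!: onorm_le\<close>)
  have supp: "F z = 0" if "z \<notin> cball c r" for z using P0[OF that] by (simp add: F_def)
  have quot: "((\<lambda>t. (F (z + of_real t * e) - F z) / of_real t) \<longlongrightarrow> F' z e) (at_right 0)" for z e
  proof -
    have "((\<lambda>t. z + t *\<^sub>R e) has_derivative (\<lambda>t. t *\<^sub>R e)) (at 0)"
      by (auto intro!: derivative_eq_intros)
    then have "((\<lambda>t. F (z + t *\<^sub>R e)) has_derivative (\<lambda>t. F' z (t *\<^sub>R e))) (at 0)"
      by (rule has_derivative_compose) (use der in simp)
    moreover have "F' z (t *\<^sub>R e) = t *\<^sub>R F' z e" for t
      using has_derivative_bounded_linear[OF der] by (simp add: linear_simps)
    ultimately have "((\<lambda>t. F (z + t *\<^sub>R e)) has_derivative (\<lambda>t. t *\<^sub>R F' z e)) (at 0)"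
      by simp
    then have "((\<lambda>t. cmod (F (z + t *\<^sub>R e) - F z - t *\<^sub>R F' z e) / \<bar>t\<bar>) \<longlongrightarrow> 0) (at 0)"
      by (simp add: has_derivative_at)
    then have lim: "((\<lambda>t. cmod (F (z + t *\<^sub>R e) - F z - t *\<^sub>R F' z e) / \<bar>t\<bar>) \<longlongrightarrow> 0) (at_right 0)"
      by (rule tendsto_within_subset) simp
    have "((\<lambda>t. cmod ((F (z + of_real t * e) - F z) / of_real t - F' z e)) \<longlongrightarrow> 0) (at_right 0)"
    proof (rule Lim_transform_eventually[OF lim])
      show "\<forall>\<^sub>F t in at_right 0. cmod (F (z + t *\<^sub>R e) - F z - t *\<^sub>R F' z e) / \<bar>t\<bar> =
          cmod ((F (z + of_real t * e) - F z) / of_real t - F' z e)"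
        using eventually_at_right_less[of "0::real"]
      proof eventually_elim
        case (elim t)
        have "(F (z + of_real t * e) - F z) / of_real t - F' z e =
            (F (z + t *\<^sub>R e) - F z - t *\<^sub>R F' z e) / of_real t"
          using elim by (simp add: scaleR_conv_of_real diff_divide_distrib)
        then show ?case by (simp only: norm_divide norm_of_real)
      qed
    qed
    then have "((\<lambda>t. (F (z + of_real t * e) - F z) / of_real t - F' z e) \<longlongrightarrow> 0) (at_right 0)"
      by (rule tendsto_norm_zero_cancel)
    then show ?thesis by (rule LIM_zero_cancel)
  qed
  have I: "integrable lborel (\<lambda>z. F' z e)" "(LINT z|lborel. F' z e) = 0" if "cmod e \<le> 1" for e
    using integral_directional_derivative_eq_0[of F L c r e "\<lambda>z. F' z e"] lip supp quot that by auto
  define H where "H z = (if z \<in> unit_disc then (of_real (P z) * (z - c)) * \<phi> z else 0)" for z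
  \<comment> \<open>The derivatives in the directions 1 and \<open>\<i>\<close> are combined so that the terms with \<open>deriv \<phi>\<close> cancel.\<close>
  have comb: "F' z 1 + \<i> * F' z \<i> = - 4 * H z" for z
    by (auto simp: H_def F'_def inner_complex_def complex_eq_iff algebra_simps)
  have int: "integrable lborel (\<lambda>z. F' z 1 + \<i> * F' z \<i>)" using I(1)[of 1] I(1)[of \<i>] by simp
  have "(LINT z|lborel. F' z 1 + \<i> * F' z \<i>) = 0" using I[of 1] I[of \<i>] by simp
  then have 0: "(LINT z|lborel. H z) = 0"
    unfolding comb by simp
  have meas: "H \<in> borel_measurable lborel"
  proof -
    have "(\<lambda>z. (- 1/4) * (F' z 1 + \<i> * F' z \<i>)) \<in> borel_measurable lborel"
      using borel_measurable_integrable[OF int] by measurable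
    then show ?thesis unfolding comb by simp
  qed
  have "(LINT z|disc_measure. (of_real (P z) * (z - c)) * \<phi> z)
      = (LINT z|lebesgue. H z)"
    unfolding H_def by (rule Lebesgue_Measure.integral_restrict_UNIV[symmetric]) simp
  also have "\<dots> = (LINT z|lborel. H z)"
    by (rule integral_completion[OF meas])
  finally show ?thesis using 0 by (simp add: P_def)
qed

section \<open>A thin dense union of strips\<close>

lemma not_AE_open:
  assumes "open S" "S \<noteq> {}" "S \<subseteq> unit_disc"
  shows "\<not> (AE z in disc_measure. z \<notin> S)"
proof
  assume "AE z in disc_measure. z \<notin> S"
  then have "AE z in lebesgue. z \<notin> S"
    using assms(3) by (auto simp: AE_restrict_space_iff elim!: eventually_mono)
  then have "S \<in> null_sets lebesgue"
    using assms(1) by (subst AE_iff_null_sets) auto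
  then show False
    using open_not_negligible[OF assms(1,2)] by (simp add: negligible_iff_null_sets)
qed

lemma emeasure_cbox_complex:
  assumes "a \<le> b" "c \<le> d"
  shows "emeasure lebesgue (cbox (Complex a c) (Complex b d)) = ennreal ((b - a) * (d - c))"
  using assms by (simp add: emeasure_lborel_cbox_eq Basis_complex_def inner_complex_def)

text \<open>To the right of 0, the set \<open>U\<close> consists of small intervals about the rationals, cut off at 0, and of a
  neighbourhood of 0.  The strips over the small intervals cover at most area \<open>1/16\<close> of a box of area \<open>1/8\<close>
  in the disc.\<close>
proposition thin_dense_open:
  obtains U :: "real set" where "open U" "{-1/8<..<1/8} \<subseteq> U" "U \<subseteq> {-1/8<..}"
    "\<And>a b. 0 \<le> a \<Longrightarrow> a < b \<Longrightarrow> \<exists>t\<in>U. a < t \<and> t < b"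
    "\<not> (AE z in disc_measure. Re z > 0 \<longrightarrow> Re z \<in> U)"
proof -
  define q where "q j = real_of_rat (from_nat j)" for j
  define \<delta> :: "nat \<Rightarrow> real" where "\<delta> j = (1/2)^Suc j / 16" for j
  have \<delta>: "\<delta> j > 0" for j by (simp add: \<delta>_def)
  define V where "V = (\<Union>j. {q j - \<delta> j<..<q j + \<delta> j})"
  define U where "U = {-1/8<..<1/8} \<union> (V \<inter> {0<..})"
  show thesis
  proof (rule that)
    show "open U" unfolding U_def V_def by (intro open_Un open_Int open_UN) auto
    show "{-1/8<..<1/8} \<subseteq> U" by (simp add: U_def)
    show "U \<subseteq> {-1/8<..}" by (auto simp: U_def)
    show "\<exists>t\<in>U. a < t \<and> t < b" if ab: "0 \<le> a" "a < b" for a b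
    proof -
      obtain r :: rat where r: "a < of_rat r" "of_rat r < b" using of_rat_dense[OF ab(2)] by blast
      have "of_rat r = q (to_nat r)" by (simp add: q_def)
      then have "of_rat r \<in> {q (to_nat r) - \<delta> (to_nat r)<..<q (to_nat r) + \<delta> (to_nat r)}"
        using \<delta>[of "to_nat r"] by simp
      then have "of_rat r \<in> V" unfolding V_def by blast
      moreover have "(of_rat r :: real) > 0" using r(1) ab(1) by linarith
      ultimately have "of_rat r \<in> U" by (simp add: U_def)
      then show ?thesis using r by blast
    qed
    show "\<not> (AE z in disc_measure. Re z > 0 \<longrightarrow> Re z \<in> U)"
    proof
      assume AE: "AE z in disc_measure. Re z > 0 \<longrightarrow> Re z \<in> U"
      define K where "K = cbox (Complex (1/4) 0) (Complex (1/2) (1/2))"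
      define S where "S j = cbox (Complex (q j - \<delta> j) 0) (Complex (q j + \<delta> j) (1/2))" for j
      have "AE z in lebesgue. z \<in> unit_disc \<longrightarrow> Re z > 0 \<longrightarrow> Re z \<in> U"
        using AE by (simp add: AE_restrict_space_iff)
      then have "AE z in lebesgue. z \<in> K \<longrightarrow> z \<in> (\<Union>j. S j)"
      proof eventually_elim
        case (elim z)
        show ?case
        proof
          assume "z \<in> K"
          then have z: "1/4 \<le> Re z" "Re z \<le> 1/2" "0 \<le> Im z" "Im z \<le> 1/2"
            by (auto simp: K_def in_cbox_complex_iff)
          have "(cmod z)^2 \<le> (1/2)^2 + (1/2)^2"
            unfolding cmod_power2 using z by (intro add_mono power_mono) auto
          also have "\<dots> < 1^2" by (simp add: power2_eq_square)
          finally have "cmod z < 1" by (rule power_less_imp_less_base) simp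
          then have "Re z \<in> V" using elim z by (auto simp: U_def)
          then obtain j where "q j - \<delta> j < Re z" "Re z < q j + \<delta> j" by (auto simp: V_def)
          then show "z \<in> (\<Union>j. S j)" using z by (auto simp: S_def in_cbox_complex_iff intro!: exI[of _ j])
        qed
      qed
      then have "emeasure lebesgue K \<le> emeasure lebesgue (\<Union>j. S j)"
        by (rule emeasure_mono_AE) (auto simp: S_def)
      also have "\<dots> \<le> (\<Sum>j. emeasure lebesgue (S j))"
        by (rule emeasure_subadditive_countably) (auto simp: S_def)
      also have "\<dots> = (\<Sum>j. ennreal (\<delta> j))"
      proof -
        have "emeasure lebesgue (S j) = ennreal (\<delta> j)" for j
          unfolding S_def using \<delta>[of j] by (subst emeasure_cbox_complex) simp_all
        then show ?thesis by presburger
      qed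
      also have "\<dots> = ennreal (1/16)"
        using \<delta> sums_divide[OF power_half_series, of 16]
        by (intro suminf_ennreal_eq) (auto simp: \<delta>_def less_imp_le)
      also have "emeasure lebesgue K = ennreal (1/8)"
        unfolding K_def by (subst emeasure_cbox_complex) simp_all
      finally show False by (simp add: ennreal_le_iff)
    qed
  qed
qed

section \<open>The class without extremal coefficient of constant modulus\<close>

theorem theorem2:
  shows "\<exists>P\<in>B_disc.
    (\<exists>\<mu>\<in>P. \<exists>\<nu>\<in>P. extremal_beltrami_coefficient \<mu> \<and> extremal_beltrami_coefficient \<nu> \<and>
       \<not> (AE z in disc_measure. \<mu> z = \<nu> z)) \<and>
    \<not> (\<exists>\<mu>\<in>P. extremal_beltrami_coefficient \<mu> \<and> constant_modulus \<mu>)"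
proof -
  obtain U :: "real set" where U: "open U" "{-1/8<..<1/8} \<subseteq> U" "U \<subseteq> {-1/8<..}"
    and dense: "\<And>a b. 0 \<le> a \<Longrightarrow> a < b \<Longrightarrow> \<exists>t\<in>U. a < t \<and> t < b"
    and thin: "\<not> (AE z in disc_measure. Re z > 0 \<longrightarrow> Re z \<in> U)"
    by (rule thin_dense_open, rule that)
  have fat: "\<not> (AE z in disc_measure. Re z \<notin> U)"
  proof
    assume "AE z in disc_measure. Re z \<notin> U"
    then have "AE z in disc_measure. z \<notin> ball 0 (1/8)"
    proof eventually_elim
      case (elim z)
      then have "Re z \<notin> {-1/8<..<1/8}" using U(2) by blast
      then show ?case using abs_Re_le_cmod[of z] by auto
    qed
    moreover have "ball 0 (1/8) \<subseteq> unit_disc" by (rule subset_ball) simp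
    ultimately show False using not_AE_open[of "ball 0 (1/8)"] by simp
  qed
  obtain \<mu> where \<mu>m: "\<mu> \<in> borel_measurable disc_measure"
    and \<mu>U: "\<And>z. z \<in> unit_disc \<Longrightarrow> Re z \<in> U \<Longrightarrow> cmod (\<mu> z) = 1/2"
    and \<mu>0: "\<And>z. Re z \<notin> U \<Longrightarrow> \<mu> z = 0"
    and forced: "\<And>\<nu>. \<nu> \<in> Linf_disc \<Longrightarrow> inf_equivalent \<nu> \<mu> \<Longrightarrow>
       AE z in disc_measure. cmod (\<nu> z) \<le> 1/2 \<Longrightarrow> AE z in disc_measure. Re z \<in> U \<longrightarrow> \<nu> z = \<mu> z"
    by (rule forced_coefficient[OF U(1), of "1/2"], simp, rule that)
  have \<mu>le: "cmod (\<mu> z) \<le> 1/2" if "z \<in> unit_disc" for z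
    using \<mu>U[OF that] \<mu>0[of z] by (cases "Re z \<in> U") auto
  have \<mu>L: "\<mu> \<in> Linf_disc" using \<mu>le by (intro Linf_disc_I[where c="1/2"] \<mu>m AE_I2) auto
  have \<mu>B: "\<mu> \<in> B_class \<mu>" using \<mu>L by (simp add: B_class_def inf_equivalent_def)
  have normI: "Linf_norm \<nu> \<le> ereal (1/2)"
    if "\<nu> \<in> borel_measurable disc_measure" "\<And>z. z \<in> unit_disc \<Longrightarrow> cmod (\<nu> z) \<le> 1/2" for \<nu>
    unfolding Linf_norm_def using that by (intro esssup_I AE_I2) auto
  have AE_norm: "AE z in disc_measure. ereal (cmod (\<nu> z)) \<le> Linf_norm \<nu>" for \<nu>
    unfolding Linf_norm_def by (rule esssup_AE)
  have AE_le: "AE z in disc_measure. cmod (\<nu> z) \<le> 1/2" if "Linf_norm \<nu> \<le> ereal (1/2)" for \<nu>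
    using AE_norm[of \<nu>]
  proof eventually_elim
    case (elim z)
    have "ereal (cmod (\<nu> z)) \<le> ereal (1/2)" using elim that by (rule order_trans)
    then show ?case by simp
  qed
  have lower: "ereal (1/2) \<le> Linf_norm \<nu>" if \<nu>: "\<nu> \<in> B_class \<mu>" for \<nu>
  proof (rule ccontr)
    assume "\<not> ereal (1/2) \<le> Linf_norm \<nu>"
    then have lt: "Linf_norm \<nu> < ereal (1/2)" by simp
    have "AE z in disc_measure. Re z \<in> U \<longrightarrow> \<nu> z = \<mu> z"
      using \<nu> AE_le[OF less_imp_le[OF lt]] by (intro forced) (auto simp: B_class_def)
    then have "AE z in disc_measure. Re z \<notin> U"
      using AE_norm[of \<nu>] AE_space
    proof eventually_elim
      case (elim z)
      have "ereal (cmod (\<nu> z)) < ereal (1/2)" using elim(2) lt by (rule le_less_trans)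
      then show ?case using elim(1,3) \<mu>U[of z] by auto
    qed
    then show False using fat by blast
  qed
  have inf: "(INF \<nu>\<in>B_class \<mu>. Linf_norm \<nu>) = ereal (1/2)"
  proof (rule antisym)
    show "(INF \<nu>\<in>B_class \<mu>. Linf_norm \<nu>) \<le> ereal (1/2)"
      by (rule INF_lower2[OF \<mu>B]) (rule normI[OF \<mu>m \<mu>le])
    show "ereal (1/2) \<le> (INF \<nu>\<in>B_class \<mu>. Linf_norm \<nu>)"
      by (intro INF_greatest lower)
  qed
  have P: "B_class \<mu> \<in> B_disc" using \<mu>L by (auto simp: B_disc_eq)
  have ext: "extremal_beltrami_coefficient \<nu> \<longleftrightarrow> Linf_norm \<nu> = ereal (1/2)" if "\<nu> \<in> B_class \<mu>" for \<nu>
  proof -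
    have "B_class \<nu> = B_class \<mu>" using B_disc_member[OF P that] .
    then show ?thesis using that inf
      by (auto simp: extremal_beltrami_coefficient_def extremal_def B_class_def one_ereal_def)
  qed
  have ext_le: "extremal_beltrami_coefficient \<nu>" if "\<nu> \<in> B_class \<mu>" "Linf_norm \<nu> \<le> ereal (1/2)" for \<nu>
    using ext[OF that(1)] that(2) lower[OF that(1)] by (simp add: antisym)

  \<comment> \<open>A second extremal coefficient: perturb \<open>\<mu>\<close> in a disc that lies left of the strips,
    where \<open>\<mu>\<close> vanishes.\<close>
  define c :: complex where "c = - 1/2"
  define b where "b z = of_real (max 0 ((1/4)^2 - (cmod (z - c))^2)) * (z - c)" for z
  define \<nu> where "\<nu> z = \<mu> z + b z" for z
  have sub: "cball c (1/4) \<subseteq> unit_disc"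
  proof
    fix z assume "z \<in> cball c (1/4)"
    then have "cmod (z - c) \<le> 1/4" by (simp add: dist_norm norm_minus_commute)
    then show "z \<in> unit_disc" using norm_triangle_ineq[of "z - c" c] by (simp add: c_def)
  qed
  have b_out: "b z = 0" if "cmod (z - c) \<ge> 1/4" for z
  proof -
    have "(1/4)^2 \<le> (cmod (z - c))^2" using that by (intro power_mono) auto
    then show ?thesis by (simp add: b_def)
  qed
  have b_le: "cmod (b z) \<le> 1/2" for z
  proof (cases "cmod (z - c) \<ge> 1/4")
    case False
    have "cmod (b z) = max 0 ((1/4)^2 - (cmod (z - c))^2) * cmod (z - c)" by (simp add: b_def norm_mult)
    also have "\<dots> \<le> (1/4)^2 * (1/4)" using False by (intro mult_mono) auto
    also have "\<dots> \<le> 1/2" by (simp add: power2_eq_square)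
    finally show ?thesis .
  qed (simp add: b_out)
  have in_disc: "Re z \<notin> U" if "cmod (z - c) < 1/4" for z
  proof -
    have "Re z < -1/8" using that abs_Re_le_cmod[of "z - c"] by (simp add: c_def)
    then show ?thesis using U(3) by auto
  qed
  have \<nu>le: "cmod (\<nu> z) \<le> 1/2" if "z \<in> unit_disc" for z
    using b_le[of z] b_out[of z] \<mu>le[OF that] \<mu>0[OF in_disc[of z]]
    by (cases "cmod (z - c) \<ge> 1/4") (auto simp: \<nu>_def)
  have "continuous_on UNIV b" unfolding b_def by (intro continuous_intros)
  then have bm: "b \<in> borel_measurable disc_measure"
    by (intro continuous_imp_measurable_on_sets_lebesgue) (auto intro: continuous_on_subset)
  have \<nu>m: "\<nu> \<in> borel_measurable disc_measure"
    unfolding \<nu>_def using \<mu>m bm by (rule borel_measurable_add)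
  have bL: "b \<in> Linf_disc" using b_le by (intro Linf_disc_I[where c="1/2"] bm AE_I2) auto
  have "(LINT z|disc_measure. \<nu> z * \<phi> z) = (LINT z|disc_measure. \<mu> z * \<phi> z)" if \<phi>: "\<phi> \<in> A_disc" for \<phi>
  proof -
    have "(LINT z|disc_measure. b z * \<phi> z) = 0"
      unfolding b_def by (rule annihilator_bump[OF _ sub \<phi>]) simp
    then show ?thesis
      using integrable_Linf_mult[OF \<mu>L \<phi>] integrable_Linf_mult[OF bL \<phi>]
      by (simp add: \<nu>_def distrib_right)
  qed
  then have \<nu>B: "\<nu> \<in> B_class \<mu>"
    using \<nu>le by (auto simp: B_class_def inf_equivalent_def intro!: Linf_disc_I[where c="1/2"] \<nu>m)
  have ne: "\<not> (AE z in disc_measure. \<mu> z = \<nu> z)"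
  proof
    assume "AE z in disc_measure. \<mu> z = \<nu> z"
    then have "AE z in disc_measure. z \<notin> ball c (1/4) - {c}"
    proof eventually_elim
      case (elim z)
      show ?case
      proof
        assume z: "z \<in> ball c (1/4) - {c}"
        then have "(cmod (z - c))^2 < (1/4)^2"
          by (intro power_strict_mono) (auto simp: dist_norm norm_minus_commute)
        then have "0 < max 0 ((1/4)^2 - (cmod (z - c))^2)"
          by (simp only: less_max_iff_disj diff_gt_0_iff_gt simp_thms)
        then have "complex_of_real (max 0 ((1/4)^2 - (cmod (z - c))^2)) \<noteq> 0"
          unfolding of_real_eq_0_iff by linarith
        moreover have "z - c \<noteq> 0" using z by simp
        ultimately have "b z \<noteq> 0" unfolding b_def by (rule no_zero_divisors)
        then show False using elim by (simp add: \<nu>_def)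
      qed
    qed
    moreover have "c + 1/8 \<in> ball c (1/4) - {c}" by (simp add: dist_norm)
    moreover have "open (ball c (1/4) - {c})" by (intro open_Diff) auto
    ultimately show False using not_AE_open[of "ball c (1/4) - {c}"] sub ball_subset_cball by blast
  qed

  have no_const: "\<not> constant_modulus \<kappa>" if \<kappa>: "\<kappa> \<in> B_class \<mu>" "extremal_beltrami_coefficient \<kappa>" for \<kappa>
  proof
    assume "constant_modulus \<kappa>"
    then obtain k :: real and \<phi> where k: "0 \<le> k" and ae: "AE z in disc_measure. \<phi> z \<noteq> 0"
      "AE z in disc_measure. \<kappa> z = of_real k * cnj (\<phi> z) / of_real (cmod (\<phi> z))"
      unfolding constant_modulus_def by blast
    have modk: "AE z in disc_measure. cmod (\<kappa> z) = k"
      using ae by eventually_elim (use k in \<open>simp add: norm_mult norm_divide\<close>)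
    have \<kappa>L: "\<kappa> \<in> Linf_disc" "inf_equivalent \<kappa> \<mu>" using \<kappa>(1) by (auto simp: B_class_def)
    have "Linf_norm \<kappa> \<le> ereal (1/2)" using ext[OF \<kappa>(1)] \<kappa>(2) by simp
    then have onU: "AE z in disc_measure. Re z \<in> U \<longrightarrow> \<kappa> z = \<mu> z"
      by (intro forced \<kappa>L AE_le)
    have "k = 1/2"
    proof (rule ccontr)
      assume "k \<noteq> 1/2"
      from onU modk AE_space have "AE z in disc_measure. Re z \<notin> U"
        by eventually_elim (use \<mu>U \<open>k \<noteq> 1/2\<close> in auto)
      then show False using fat by blast
    qed
    have "AE z in disc_measure. Re z > 0 \<longrightarrow> \<kappa> z - \<mu> z = 0"
    proof (rule annihilator_zero_right_half[OF U(1)])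
      show "0 \<in> U" using U(2) by auto
      show "(\<lambda>z. \<kappa> z - \<mu> z) \<in> Linf_disc" by (rule Linf_disc_diff[OF \<kappa>L(1) \<mu>L])
      show "(LINT z|disc_measure. (\<kappa> z - \<mu> z) * \<phi> z) = 0" if "\<phi> \<in> A_disc" for \<phi>
        using \<kappa>L(2) that integrable_Linf_mult[OF \<kappa>L(1) that] integrable_Linf_mult[OF \<mu>L that]
        by (simp add: inf_equivalent_def left_diff_distrib)
      show "AE z in disc_measure. Re z \<in> U \<longrightarrow> \<kappa> z - \<mu> z = 0"
        using onU by eventually_elim simp
    qed (use dense in blast)
    then have "AE z in disc_measure. Re z > 0 \<longrightarrow> Re z \<in> U"
      using modk by eventually_elim (use \<mu>0 \<open>k = 1/2\<close> in fastforce)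
    then show False using thin by blast
  qed
  have "extremal_beltrami_coefficient \<mu>" "extremal_beltrami_coefficient \<nu>"
    by (intro ext_le \<mu>B \<nu>B normI \<mu>m \<nu>m \<mu>le \<nu>le; assumption)+
  then show ?thesis using P \<mu>B \<nu>B ne no_const by blast
qed

end
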